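(* Let $(V,\mathcal{A})$ be an essential hyperplane arrangement over a subfield $k\subseteq\mathbb{C}$ and $\mathcal{G}$ a building set for $L(\mathcal{A})$ with $V^*\in\mathcal{G}$. Assume that $(V,\mathcal{A})$ has enough $\mathcal{G}$-modular elements. Then for every $X\in\mathcal{G}$, $X\neq V^*$, there is a retraction $\overline{Y}(V,\mathcal{A},\mathcal{G})\to D_X$ (a morphism restricting to the identity on $D_X$). More precisely, with respect to the isomorphism $$D_X\cong\overline{Y}(V/X^\perp,\mathcal{A}|_X,\mathcal{G}|_X)\times\overline{Y}(X^\perp,\mathcal{A}/X,\mathcal{G}/X),$$ there is a retraction $\overline{Y}(V,\mathcal{A},\mathcal{G})\to D_X$ such that: 1. its composition with the projection onto the first factor restricts to the natural quotient map $Y(V,\mathcal{A})\to Y(V/X^\perp,\mathcal{A}|_X)$; 2. its composition with the projection onto the second factor restricts to a linear projection $Y(V,\mathcal{A})\to Y(X^\perp,\mathcal{A}/X)$ (a map induced by a linear projection $V\to X^\perp$).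
   Context: A hyperplane arrangement $(V,\mathcal{A})$ over $k$ is a finite-dimensional $k$-vector space $V$ with a non-empty finite set $\mathcal{A}$ of lines (one-dimensional subspaces) of $V^*$. For $W\subseteq V^*$, $W^\perp\subseteq V$ is its common kernel. $L(\mathcal{A})$ is the set of all sums of elements of $\mathcal{A}$ (including $0$), ordered by inclusion. The arrangement is essential if $V^*\in L(\mathcal{A})$. For $X\in L(\mathcal{A})$: the arrangement $(X^\perp,\mathcal{A}/X)$ has $\mathcal{A}/X=\{(H+X)/X:H\in\mathcal{A},H\not\subseteq X\}$, with $(X^\perp)^*=V^*/X$; the arrangement $(V/X^\perp,\mathcal{A}|_X)$ has $\mathcal{A}|_X=\{H\in\mathcal{A}:H\subseteq X\}$, with $(V/X^\perp)^*=X$. A decomposition of $X\in L(\mathcal{A})$ is a set $\{X_1,\dots,X_r\}\subseteq L(\mathcal{A})\setminus\{0\}$ with $X=\bigoplus X_i$ such that for all $Y\in L(\mathcal{A})$, $Y\subseteq X$: $Y\cap X_i\in L(\mathcal{A})$ and $Y=\bigoplus_i(Y\cap X_i)$. $X\neq0$ is irreducible if $\{X\}$ is its only decomposition. A building set is $\mathcal{G}\subseteq L(\mathcal{A})\setminus\{0\}$ containing all irreducible elements such that $X,Y\in\mathcal{G}$, $X+Y\notin\mathcal{G}$ imply $X\oplus Y$ is a decomposition. For $X\in\mathcal{G}$, $\mathcal{G}|_X=\{Y\in\mathcal{G}:Y\subseteq X\}$ and $\mathcal{G}/X=\{(Y+X)/X:Y\in\mathcal{G},Y\not\subseteq X\}$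 are building sets for $L(\mathcal{A}|_X)$ and $L(\mathcal{A}/X)$. $M\in L(\mathcal{A})$ is modular if $M\cap X\in L(\mathcal{A})$ for all $X\in L(\mathcal{A})$. $M\in\mathcal{G}$ is $\mathcal{G}$-modular if it is modular and $X\cap M\in\mathcal{G}\cup\{0\}$ for all $X\in\mathcal{G}$. $(V,\mathcal{A})$ has enough $\mathcal{G}$-modular elements if for all $H\in\mathcal{A}$ there is a $\mathcal{G}$-modular $M\in\mathcal{G}$ of codimension $1$ in $V^*$ with $H\not\subseteq M$. $Y(V,\mathcal{A})=\mathbb{P}(V)\setminus\bigcup_{H\in\mathcal{A}}\mathbb{P}(H^\perp)$. $\overline{Y}(V,\mathcal{A},\mathcal{G})$ is the closure of the image of $Y(V,\mathcal{A})$ in $\prod_{Y\in\mathcal{G}}\mathbb{P}(V/Y^\perp)$ under the natural maps. It is smooth projective, and the complement of $Y(V,\mathcal{A})$ is a simple normal crossings divisor with irreducible components $D_X$, $X\in\mathcal{G}\setminus\{V^*\}$, where $D_X$ is the component with image $\mathbb{P}(X^\perp)$ in $\mathbb{P}(V)$. The isomorphism $D_X\cong\overline{Y}(V/X^\perp,\mathcal{A}|_X,\mathcal{G}|_X)\times\overline{Y}(X^\perp,\mathcal{A}/X,\mathcal{G}/X)$ (De Concini–Procesi) sends a pair $(a,b)$ to the point of $\prod_{Y\in\mathcal{G}}\mathbb{P}(V/Y^\perp)$ with $Y$-coordinate $a_Y$ if $Y\subseteq X$, and with $Y$-coordinate the image of $b_{(Y+X)/X}$ under $\mathbb{P}(X^\perp/(X+Y)^\perp)\hookrightarrow\mathbb{P}(V/Y^\perp)$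 if $Y\not\subseteq X$. *)

theory Defs
  imports "HOL-Analysis.Analysis" "HOL-Library.Function_Algebras"
begin

text \<open>
  Conventions. \<open>V\<close> is the vector space over \<open>'k\<close> formed by the type \<open>'v\<close>, and \<open>emb\<close> embeds \<open>'k\<close> into the
  complex numbers. An arrangement is presented by the dual \<open>U \<subseteq> ('v \<Rightarrow> 'k)\<close> of the vector space that
  it lives in, together with its lines in \<open>U\<close>. The three relevant duals are \<open>U = V*\<close>; \<open>U = X\<close>,
  the dual of \<open>V/X\<^sup>\<bottom>\<close>; and \<open>U = V*/X\<close>, the dual of \<open>X\<^sup>\<bottom>\<close>, which is realised by restricting the
  linear forms on \<open>V\<close> to \<open>X\<^sup>\<bottom>\<close> (extended by \<open>0\<close> outside \<open>X\<^sup>\<bottom>\<close>).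

  Varieties over \<open>'k\<close> are given by their complex points, with the Zariski topology and the regular
  maps defined by polynomials with coefficients in \<open>'k\<close>.
\<close>

definition field_embedding :: "('k::field \<Rightarrow> complex) \<Rightarrow> bool" where
  "field_embedding emb \<longleftrightarrow> emb 1 = 1 \<and>
     (\<forall>x y. emb (x + y) = emb x + emb y) \<and> (\<forall>x y. emb (x * y) = emb x * emb y)"

definition fscale :: "'k::field \<Rightarrow> ('v \<Rightarrow> 'k) \<Rightarrow> 'v \<Rightarrow> 'k" where
  "fscale c f = (\<lambda>v. c * f v)"

global_interpretation form: vector_space "fscale :: 'k::field \<Rightarrow> ('v \<Rightarrow> 'k) \<Rightarrow> 'v \<Rightarrow> 'k"
  by unfold_locales (auto simp: fscale_def fun_eq_iff algebra_simps)

definition dual :: "('k::field \<Rightarrow> 'v::ab_group_add \<Rightarrow> 'v) \<Rightarrow> ('v \<Rightarrow> 'k) set" where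
  "dual smul = {f. Vector_Spaces.linear smul (*) f}"

definition perp :: "('v \<Rightarrow> 'k::field) set \<Rightarrow> 'v set" where
  "perp X = {v. \<forall>f\<in>X. f v = 0}"


section \<open>Arrangements and building sets\<close>

definition arrangement :: "('v \<Rightarrow> 'k::field) set \<Rightarrow> ('v \<Rightarrow> 'k) set set \<Rightarrow> bool" where
  "arrangement U A \<longleftrightarrow> form.subspace U \<and> finite A \<and> A \<noteq> {} \<and>
     (\<forall>H\<in>A. H \<subseteq> U \<and> form.subspace H \<and> form.dim H = 1)"

text \<open>The lattice \<open>L(A)\<close> of all sums of members of \<open>A\<close>.\<close>
definition flats :: "('v \<Rightarrow> 'k::field) set set \<Rightarrow> ('v \<Rightarrow> 'k) set set" where
  "flats A = {form.span (\<Union>B) | B. B \<subseteq> A}"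

definition essential :: "('v \<Rightarrow> 'k::field) set \<Rightarrow> ('v \<Rightarrow> 'k) set set \<Rightarrow> bool" where
  "essential U A \<longleftrightarrow> U \<in> flats A"

definition ssum :: "'u::ab_group_add set \<Rightarrow> 'u set \<Rightarrow> 'u set" where
  "ssum X Y = {x + y | x y. x \<in> X \<and> y \<in> Y}"

text \<open>\<open>X\<close> is the internal direct sum of the subspaces \<open>F i\<close>, \<open>i \<in> I\<close>. The family is indexed because
  several \<open>F i\<close> may be the zero space.\<close>
definition direct_sum :: "'i set \<Rightarrow> ('i \<Rightarrow> 'u::ab_group_add set) \<Rightarrow> 'u set \<Rightarrow> bool" where
  "direct_sum I F X \<longleftrightarrow> finite I \<and>
     X = {\<Sum>i\<in>I. g i | g. \<forall>i\<in>I. g i \<in> F i} \<and>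
     (\<forall>g. (\<forall>i\<in>I. g i \<in> F i) \<and> (\<Sum>i\<in>I. g i) = 0 \<longrightarrow> (\<forall>i\<in>I. g i = 0))"

definition decomposition ::
  "('v \<Rightarrow> 'k::field) set set \<Rightarrow> ('v \<Rightarrow> 'k) set \<Rightarrow> ('v \<Rightarrow> 'k) set set \<Rightarrow> bool" where
  "decomposition A X D \<longleftrightarrow> X \<in> flats A \<and> D \<subseteq> flats A - {{0}} \<and> direct_sum D (\<lambda>Z. Z) X \<and>
     (\<forall>Y\<in>flats A. Y \<subseteq> X \<longrightarrow> (\<forall>Z\<in>D. Y \<inter> Z \<in> flats A) \<and> direct_sum D (\<lambda>Z. Y \<inter> Z) Y)"

definition irreducible_flat :: "('v \<Rightarrow> 'k::field) set set \<Rightarrow> ('v \<Rightarrow> 'k) set \<Rightarrow> bool" where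
  "irreducible_flat A X \<longleftrightarrow> X \<in> flats A \<and> X \<noteq> {0} \<and> (\<forall>D. decomposition A X D \<longleftrightarrow> D = {X})"

definition building_set :: "('v \<Rightarrow> 'k::field) set set \<Rightarrow> ('v \<Rightarrow> 'k) set set \<Rightarrow> bool" where
  "building_set A G \<longleftrightarrow> G \<subseteq> flats A - {{0}} \<and> (\<forall>X. irreducible_flat A X \<longrightarrow> X \<in> G) \<and>
     (\<forall>X\<in>G. \<forall>Y\<in>G. ssum X Y \<notin> G \<longrightarrow> X \<noteq> Y \<and> decomposition A (ssum X Y) {X, Y})"

text \<open>\<open>restr_sub A X\<close> is \<open>A|\<^sub>X\<close>, and \<open>restr_quot A X\<close> is \<open>A/X\<close>; both are also used for building sets.
  The kernel of \<open>res_form X\<close> on \<open>V*\<close> is \<open>X\<close>, so the image of a subspace \<open>Y\<close> of \<open>V*\<close> is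
  \<open>(Y + X)/X \<subseteq> V*/X = (X\<^sup>\<bottom>)*\<close>.\<close>
definition restr_sub :: "('v \<Rightarrow> 'k::field) set set \<Rightarrow> ('v \<Rightarrow> 'k) set \<Rightarrow> ('v \<Rightarrow> 'k) set set" where
  "restr_sub A X = {H \<in> A. H \<subseteq> X}"

definition res_form :: "('v \<Rightarrow> 'k::field) set \<Rightarrow> ('v \<Rightarrow> 'k) \<Rightarrow> 'v \<Rightarrow> 'k" where
  "res_form X f = (\<lambda>v. if v \<in> perp X then f v else 0)"

definition restr_quot :: "('v \<Rightarrow> 'k::field) set set \<Rightarrow> ('v \<Rightarrow> 'k) set \<Rightarrow> ('v \<Rightarrow> 'k) set set" where
  "restr_quot A X = {res_form X ` H | H. H \<in> A \<and> \<not> H \<subseteq> X}"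

definition modular :: "('v \<Rightarrow> 'k::field) set set \<Rightarrow> ('v \<Rightarrow> 'k) set \<Rightarrow> bool" where
  "modular A M \<longleftrightarrow> M \<in> flats A \<and> (\<forall>X\<in>flats A. M \<inter> X \<in> flats A)"

definition G_modular ::
  "('v \<Rightarrow> 'k::field) set set \<Rightarrow> ('v \<Rightarrow> 'k) set set \<Rightarrow> ('v \<Rightarrow> 'k) set \<Rightarrow> bool" where
  "G_modular A G M \<longleftrightarrow> M \<in> G \<and> modular A M \<and> (\<forall>X\<in>G. X \<inter> M \<in> G \<union> {{0}})"

definition enough_G_modular ::
  "('v \<Rightarrow> 'k::field) set \<Rightarrow> ('v \<Rightarrow> 'k) set set \<Rightarrow> ('v \<Rightarrow> 'k) set set \<Rightarrow> bool" where
  "enough_G_modular U A G \<longleftrightarrow>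
     (\<forall>H\<in>A. \<exists>M. G_modular A G M \<and> form.dim M + 1 = form.dim U \<and> \<not> H \<subseteq> M)"


section \<open>Products of projective spaces\<close>

text \<open>For a subspace \<open>W\<close> of forms, dual to a space \<open>E\<close>, \<open>points emb W\<close> is the set of complex points
  of \<open>E\<close>, that is the \<open>'k\<close>-linear maps from \<open>W\<close> to the complex numbers, normalised to be \<open>0\<close> outside
  \<open>W\<close>; \<open>proj emb W\<close> is the set of complex points of \<open>\<P>(E)\<close>, that is the complex lines in it.\<close>
definition points ::
  "('k::field \<Rightarrow> complex) \<Rightarrow> ('v \<Rightarrow> 'k) set \<Rightarrow> (('v \<Rightarrow> 'k) \<Rightarrow> complex) set" where
  "points emb W = {\<phi>. (\<forall>f\<in>W. \<forall>g\<in>W. \<phi> (f + g) = \<phi> f + \<phi> g) \<and>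
     (\<forall>c. \<forall>f\<in>W. \<phi> (fscale c f) = emb c * \<phi> f) \<and> (\<forall>f. f \<notin> W \<longrightarrow> \<phi> f = 0)}"

definition line :: "('u \<Rightarrow> complex) \<Rightarrow> ('u \<Rightarrow> complex) set" where
  "line \<phi> = {(\<lambda>f. c * \<phi> f) | c. True}"

definition proj ::
  "('k::field \<Rightarrow> complex) \<Rightarrow> ('v \<Rightarrow> 'k) set \<Rightarrow> (('v \<Rightarrow> 'k) \<Rightarrow> complex) set set" where
  "proj emb W = {line \<phi> | \<phi>. \<phi> \<in> points emb W \<and> \<phi> \<noteq> (\<lambda>_. 0)}"

text \<open>The closed subset \<open>\<P>(X\<^sup>\<bottom>)\<close> of \<open>\<P>(E)\<close>, for \<open>X \<subseteq> W\<close>.\<close>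
definition proj_perp ::
  "('k::field \<Rightarrow> complex) \<Rightarrow> ('v \<Rightarrow> 'k) set \<Rightarrow> ('v \<Rightarrow> 'k) set \<Rightarrow> (('v \<Rightarrow> 'k) \<Rightarrow> complex) set set" where
  "proj_perp emb W X = {l \<in> proj emb W. \<forall>\<phi>\<in>l. \<forall>f\<in>X. \<phi> f = 0}"

text \<open>A linear map \<open>T: W \<rightarrow> W'\<close> of dual spaces induces a map \<open>pull W T\<close> from points of the space
  dual to \<open>W'\<close> to points of the space dual to \<open>W\<close>.\<close>
definition pull :: "'w set \<Rightarrow> ('w \<Rightarrow> 'u) \<Rightarrow> ('u \<Rightarrow> complex) \<Rightarrow> 'w \<Rightarrow> complex" where
  "pull W T \<phi> = (\<lambda>f. if f \<in> W then \<phi> (T f) else 0)"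

definition pull_line :: "'w set \<Rightarrow> ('w \<Rightarrow> 'u) \<Rightarrow> ('u \<Rightarrow> complex) set \<Rightarrow> ('w \<Rightarrow> complex) set" where
  "pull_line W T l = pull W T ` l"

type_synonym ('v, 'k) mpoint = "('v \<Rightarrow> 'k) set \<Rightarrow> (('v \<Rightarrow> 'k) \<Rightarrow> complex) set"

text \<open>The product, over \<open>Y \<in> S\<close>, of the projective spaces of the spaces dual to \<open>Y\<close>.\<close>
definition mproj ::
  "('k::field \<Rightarrow> complex) \<Rightarrow> ('v \<Rightarrow> 'k) set set \<Rightarrow> ('v, 'k) mpoint set" where
  "mproj emb S = (\<Pi>\<^sub>E Y\<in>S. proj emb Y)"

definition reps ::
  "('v \<Rightarrow> 'k::field) set set \<Rightarrow> ('v, 'k) mpoint \<Rightarrow> (('v \<Rightarrow> 'k) set \<Rightarrow> ('v \<Rightarrow> 'k) \<Rightarrow> complex) set" where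
  "reps S p = {\<Phi>. \<forall>Y\<in>S. \<Phi> Y \<in> p Y \<and> \<Phi> Y \<noteq> (\<lambda>_. 0)}"

text \<open>Multihomogeneous polynomial functions with coefficients in \<open>'k\<close>, with their multidegree. The
  homogeneous coordinates of the \<open>Y\<close>-th factor are the evaluations at the elements of \<open>Y\<close>.\<close>
inductive multihom ::
  "('k::field \<Rightarrow> complex) \<Rightarrow> ('v \<Rightarrow> 'k) set set \<Rightarrow> (('v \<Rightarrow> 'k) set \<Rightarrow> nat) \<Rightarrow>
   ((('v \<Rightarrow> 'k) set \<Rightarrow> ('v \<Rightarrow> 'k) \<Rightarrow> complex) \<Rightarrow> complex) \<Rightarrow> bool"
  for emb :: "'k::field \<Rightarrow> complex" and S :: "('v \<Rightarrow> 'k) set set" where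
  const: "multihom emb S (\<lambda>_. 0) (\<lambda>_. emb c)"
| coord: "Y \<in> S \<Longrightarrow> f \<in> Y \<Longrightarrow> multihom emb S (\<lambda>Z. if Z = Y then 1 else 0) (\<lambda>\<Phi>. \<Phi> Y f)"
| add: "multihom emb S d P \<Longrightarrow> multihom emb S d Q \<Longrightarrow> multihom emb S d (\<lambda>\<Phi>. P \<Phi> + Q \<Phi>)"
| mult: "multihom emb S d P \<Longrightarrow> multihom emb S e Q \<Longrightarrow>
    multihom emb S (\<lambda>Z. d Z + e Z) (\<lambda>\<Phi>. P \<Phi> * Q \<Phi>)"

definition zariski ::
  "('k::field \<Rightarrow> complex) \<Rightarrow> ('v \<Rightarrow> 'k) set set \<Rightarrow> ('v, 'k) mpoint topology" where
  "zariski emb S = topology_generated_by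
     {{p \<in> mproj emb S. \<forall>\<Phi>\<in>reps S p. P \<Phi> \<noteq> 0} | P. \<exists>d. multihom emb S d P}"

text \<open>\<open>r\<close> is a morphism over \<open>'k\<close> from \<open>D \<subseteq> mproj emb S\<close> to \<open>E \<subseteq> mproj emb T\<close>: locally, each
  component is given by multihomogeneous polynomials of one common multidegree. They have no common
  zero, because \<open>r q Z\<close> is a line.\<close>
definition regular_map ::
  "('k::field \<Rightarrow> complex) \<Rightarrow> ('v \<Rightarrow> 'k) set set \<Rightarrow> ('v, 'k) mpoint set \<Rightarrow>
   ('v \<Rightarrow> 'k) set set \<Rightarrow> ('v, 'k) mpoint set \<Rightarrow> (('v, 'k) mpoint \<Rightarrow> ('v, 'k) mpoint) \<Rightarrow> bool" where
  "regular_map emb S D T E r \<longleftrightarrow> D \<subseteq> mproj emb S \<and> E \<subseteq> mproj emb T \<and> r ` D \<subseteq> E \<and>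
     (\<forall>p\<in>D. \<forall>Z\<in>T. \<exists>N d F. openin (zariski emb S) N \<and> p \<in> N \<and>
        (\<forall>f\<in>Z. multihom emb S d (F f)) \<and>
        (\<forall>q\<in>N \<inter> D. \<forall>\<Phi>\<in>reps S q. r q Z = line (\<lambda>f. if f \<in> Z then F f \<Phi> else 0)))"

definition irreducible_in :: "'p topology \<Rightarrow> 'p set \<Rightarrow> bool" where
  "irreducible_in T C \<longleftrightarrow> C \<subseteq> topspace T \<and> C \<noteq> {} \<and>
     (\<forall>C1 C2. closedin T C1 \<longrightarrow> closedin T C2 \<longrightarrow> C \<subseteq> C1 \<union> C2 \<longrightarrow> C \<subseteq> C1 \<or> C \<subseteq> C2)"

definition irreducible_component :: "'p topology \<Rightarrow> 'p set \<Rightarrow> 'p set \<Rightarrow> bool" where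
  "irreducible_component T S C \<longleftrightarrow> C \<subseteq> S \<and> irreducible_in T C \<and>
     (\<forall>C'. C \<subseteq> C' \<longrightarrow> C' \<subseteq> S \<longrightarrow> irreducible_in T C' \<longrightarrow> C' = C)"


section \<open>The wonderful compactification\<close>

definition Y_open ::
  "('k::field \<Rightarrow> complex) \<Rightarrow> ('v \<Rightarrow> 'k) set \<Rightarrow> ('v \<Rightarrow> 'k) set set \<Rightarrow> (('v \<Rightarrow> 'k) \<Rightarrow> complex) set set" where
  "Y_open emb U A = proj emb U - (\<Union>H\<in>A. proj_perp emb U H)"

definition Y_emb ::
  "('v \<Rightarrow> 'k::field) set set \<Rightarrow> (('v \<Rightarrow> 'k) \<Rightarrow> complex) set \<Rightarrow> ('v, 'k) mpoint" where
  "Y_emb G l = (\<lambda>Y\<in>G. pull_line Y (\<lambda>f. f) l)"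

definition Y_bar ::
  "('k::field \<Rightarrow> complex) \<Rightarrow> ('v \<Rightarrow> 'k) set \<Rightarrow> ('v \<Rightarrow> 'k) set set \<Rightarrow> ('v \<Rightarrow> 'k) set set \<Rightarrow>
   ('v, 'k) mpoint set" where
  "Y_bar emb U A G = zariski emb G closure_of (Y_emb G ` Y_open emb U A)"

text \<open>The component \<open>D\<^sub>X\<close> of the boundary, for \<open>U \<in> G\<close>: the \<open>U\<close>-th coordinate is the map to
  \<open>\<P>(V)\<close>.\<close>
definition boundary_divisor ::
  "('k::field \<Rightarrow> complex) \<Rightarrow> ('v \<Rightarrow> 'k) set \<Rightarrow> ('v \<Rightarrow> 'k) set set \<Rightarrow> ('v \<Rightarrow> 'k) set set \<Rightarrow>
   ('v \<Rightarrow> 'k) set \<Rightarrow> ('v, 'k) mpoint set" where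
  "boundary_divisor emb U A G X =
     (THE D. irreducible_component (zariski emb G)
               (Y_bar emb U A G - Y_emb G ` Y_open emb U A) D \<and>
             (\<lambda>p. p U) ` D = proj_perp emb U X)"

text \<open>The De Concini--Procesi map onto \<open>D\<^sub>X\<close>. For \<open>Y\<close> not contained in \<open>X\<close>, the inclusion of
  \<open>X\<^sup>\<bottom>/(X + Y)\<^sup>\<bottom>\<close> in \<open>V/Y\<^sup>\<bottom>\<close> is dual to the surjection \<open>Y \<rightarrow> (Y + X)/X\<close>.\<close>
definition dcp_map ::
  "('v \<Rightarrow> 'k::field) set set \<Rightarrow> ('v \<Rightarrow> 'k) set \<Rightarrow> ('v, 'k) mpoint \<times> ('v, 'k) mpoint \<Rightarrow> ('v, 'k) mpoint" where
  "dcp_map G X = (\<lambda>(a, b). \<lambda>Y\<in>G.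
     if Y \<subseteq> X then a Y else pull_line Y (res_form X) (b (res_form X ` Y)))"

text \<open>Its inverse, giving the two projections of \<open>D\<^sub>X\<close> onto the factors.\<close>
definition dcp_inv ::
  "('k::field \<Rightarrow> complex) \<Rightarrow> ('v \<Rightarrow> 'k) set \<Rightarrow> ('v \<Rightarrow> 'k) set set \<Rightarrow> ('v \<Rightarrow> 'k) set set \<Rightarrow>
   ('v \<Rightarrow> 'k) set \<Rightarrow> ('v, 'k) mpoint \<Rightarrow> ('v, 'k) mpoint \<times> ('v, 'k) mpoint" where
  "dcp_inv emb U A G X = the_inv_into
     (Y_bar emb X (restr_sub A X) (restr_sub G X) \<times>
      Y_bar emb (res_form X ` U) (restr_quot A X) (restr_quot G X))
     (dcp_map G X)"

definition linear_projection ::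
  "('k::field \<Rightarrow> 'v::ab_group_add \<Rightarrow> 'v) \<Rightarrow> 'v set \<Rightarrow> ('v \<Rightarrow> 'v) \<Rightarrow> bool" where
  "linear_projection smul W \<pi> \<longleftrightarrow> Vector_Spaces.linear smul smul \<pi> \<and> range \<pi> \<subseteq> W \<and> (\<forall>w\<in>W. \<pi> w = w)"

end

(* Intersecting G-modular hyperplanes gives a modular complement N of X whose intersection with each
   member of G is 0 or in G. Let tau be the projection of V* onto N along X. For Y in G not contained
   in X, tau(Y) is again in G: it is (Y + X) Int N if Y + X is in G, and Y itself otherwise. Hence
   p |-> r p, with (r p)_Y = p_Y for Y <= X and (r p)_Y = tau^*(p_{tau Y}) otherwise, is a morphism of
   the whole product of projective spaces.

   The image of a generic point phi under r is the limit, for t -> 0, of the pencil phi o tau + t phi,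
   so r maps Y_bar to itself, and r is the identity on the closed subset of Y_bar where p_Y vanishes
   on Y Int X for all Y not contained in X. So this subset is r(Y_bar), hence irreducible; as the
   subsets of this kind cover the boundary, they are its components, and this one is D_X. *)

theory Submission
  imports Defs
begin

section \<open>Points and lines\<close>

text \<open>Points are complex while equations have coefficients in k. Limits and density are
  handled by complex pencils: all but finitely many parameters of a suitable pencil lie in the open
  part, and a polynomial in the parameter with infinitely many zeros is zero.

  The obstacle is that D_X is characterised as a component of the boundary with a given image in
  P(V), so that identifying it requires knowledge of all the components. Hence every Z in
  \<open>G\<close> other than \<open>U\<close>, and not only X, needs a complement: the candidate
  for D_Z is irreducible because it is a continuous image of \<open>Ybar\<close>.

  The complement is cut out by G-modular hyperplanes because this makes tau(Y) a member of
  \<open>G\<close>, so that the factor to be read from exists in the product. The product structure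
  of D_X enters through \<open>dcp_map\<close> alone: on the open part the image under r is an
  explicit value of it, and injectivity then evaluates \<open>dcp_inv\<close>.\<close>

lemma field_embedding_simps:
  assumes "field_embedding emb"
  shows "emb 0 = 0" "emb 1 = 1" "emb (x + y) = emb x + emb y" "emb (x * y) = emb x * emb y"
    "emb (- x) = - emb x" "emb x = 0 \<longleftrightarrow> x = 0"
proof -
  show add: "emb (x + y) = emb x + emb y" for x y
    using assms by (auto simp: field_embedding_def)
  show mult: "emb (x * y) = emb x * emb y" for x y
    using assms by (auto simp: field_embedding_def)
  show one: "emb 1 = 1"
    using assms by (auto simp: field_embedding_def)
  show zero: "emb 0 = 0"
    using add[of 0 0] by simp
  show "emb (- x) = - emb x"
    using add[of x "- x"] zero by (simp add: eq_neg_iff_add_eq_0 add.commute)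
  show "emb x = 0 \<longleftrightarrow> x = 0"
    using mult[of x "inverse x"] zero one by (cases "x = 0") auto
qed

lemma line_self: "\<phi> \<in> line \<phi>"
  unfolding line_def by (auto intro: exI[of _ 1])

lemma line_eqI:
  assumes "\<psi> \<in> line \<phi>" "\<psi> \<noteq> (\<lambda>_. 0)"
  shows "line \<psi> = line \<phi>"
proof -
  obtain c where c: "\<psi> = (\<lambda>f. c * \<phi> f)"
    using assms(1) by (auto simp: line_def)
  then have "c \<noteq> 0"
    using assms(2) by auto
  have "(\<lambda>f. d * \<phi> f) = (\<lambda>f. d / c * \<psi> f)" for d
    using \<open>c \<noteq> 0\<close> by (simp add: c)
  then have "line \<phi> \<subseteq> line \<psi>"
    unfolding line_def by blast
  moreover have "(\<lambda>f. d * \<psi> f) = (\<lambda>f. d * c * \<phi> f)" for d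
    by (simp add: c mult.assoc)
  then have "line \<psi> \<subseteq> line \<phi>"
    unfolding line_def by blast
  ultimately show ?thesis
    by blast
qed

lemma pull_line_line: "pull_line W T (line \<phi>) = line (pull W T \<phi>)"
proof -
  have "pull W T (\<lambda>f. c * \<phi> f) = (\<lambda>f. c * pull W T \<phi> f)" for c
    by (auto simp: pull_def)
  then show ?thesis
    unfolding pull_line_def line_def by (auto simp: image_def)
qed

lemma pull_pull: "(\<And>f. f \<in> W \<Longrightarrow> T f \<in> W') \<Longrightarrow> pull W T (pull W' T' \<phi>) = pull W (\<lambda>f. T' (T f)) \<phi>"
  by (auto simp: pull_def)

lemma pull_line_cong:
  "(\<And>f. f \<in> W \<Longrightarrow> T f = T' f) \<Longrightarrow> pull_line W T l = pull_line W T' l"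
  unfolding pull_line_def pull_def by (intro image_cong) auto

lemma points_nonzero: "\<phi> \<in> points emb W \<Longrightarrow> \<phi> \<noteq> (\<lambda>_. 0) \<Longrightarrow> \<exists>f\<in>W. \<phi> f \<noteq> 0"
  unfolding points_def by blast

lemma points_add: "\<phi> \<in> points emb W \<Longrightarrow> \<psi> \<in> points emb W \<Longrightarrow> (\<lambda>f. \<phi> f + \<psi> f) \<in> points emb W"
  by (auto simp: points_def algebra_simps)

lemma points_scale: "\<phi> \<in> points emb W \<Longrightarrow> (\<lambda>f. c * \<phi> f) \<in> points emb W"
  by (auto simp: points_def algebra_simps)

text \<open>Linearity is asked only on \<open>W\<close>: \<open>tau\<close> below is a definite
  description, about which nothing is known outside \<open>U\<close>.\<close>

definition linear_form_map :: "('v \<Rightarrow> 'k::field) set \<Rightarrow> (('v \<Rightarrow> 'k) \<Rightarrow> ('w \<Rightarrow> 'k)) \<Rightarrow> bool" where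
  "linear_form_map W T \<longleftrightarrow> (\<forall>f\<in>W. \<forall>g\<in>W. T (f + g) = T f + T g) \<and>
     (\<forall>c. \<forall>f\<in>W. T (fscale c f) = fscale c (T f))"

lemma linear_form_map_subset: "linear_form_map W T \<Longrightarrow> W' \<subseteq> W \<Longrightarrow> linear_form_map W' T"
  unfolding linear_form_map_def by blast

lemma linear_form_map_id: "linear_form_map W (\<lambda>f. f)"
  by (auto simp: linear_form_map_def)

lemma points_pull:
  assumes "form.subspace W" "linear_form_map W T" "T ` W \<subseteq> W'" "\<phi> \<in> points emb W'"
  shows "pull W T \<phi> \<in> points emb W"
  using assms form.subspace_add[OF assms(1)] form.subspace_scale[OF assms(1)]
  by (auto simp: points_def pull_def linear_form_map_def image_subset_iff)

lemma points_zero: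
  assumes "form.subspace W" "\<phi> \<in> points emb W" "field_embedding emb"
  shows "\<phi> 0 = 0"
proof -
  have "\<phi> (0 + 0) = \<phi> 0 + \<phi> 0"
    using assms form.subspace_0 unfolding points_def by blast
  then show ?thesis
    by simp
qed

lemma points_eval:
  assumes "field_embedding emb" "form.subspace W"
  shows "(\<lambda>f. if f \<in> W then emb (f v) else 0) \<in> points emb W"
  using form.subspace_add[OF assms(2)] form.subspace_scale[OF assms(2)]
  by (auto simp: points_def field_embedding_simps[OF assms(1)] fscale_def)

lemma points_diff:
  assumes "field_embedding emb" "form.subspace W" "\<phi> \<in> points emb W" "f \<in> W" "g \<in> W"
  shows "\<phi> (f - g) = \<phi> f - \<phi> g"
proof -
  have "f - g \<in> W"
    using assms form.subspace_diff by blast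
  then have "\<phi> (f - g + g) = \<phi> (f - g) + \<phi> g"
    using assms unfolding points_def by blast
  then show ?thesis
    by (simp add: algebra_simps)
qed

lemma proj_lineI: "\<phi> \<in> points emb W \<Longrightarrow> \<phi> \<noteq> (\<lambda>_. 0) \<Longrightarrow> line \<phi> \<in> proj emb W"
  by (auto simp: proj_def)

lemma projE:
  assumes "l \<in> proj emb W"
  obtains \<phi> where "l = line \<phi>" "\<phi> \<in> points emb W" "\<phi> \<noteq> (\<lambda>_. 0)"
  using assms by (auto simp: proj_def)

lemma proj_mem_points: "l \<in> proj emb W \<Longrightarrow> \<phi> \<in> l \<Longrightarrow> \<phi> \<in> points emb W"
  by (auto simp: proj_def line_def intro: points_scale)

lemma proj_eq_line: "l \<in> proj emb W \<Longrightarrow> \<phi> \<in> l \<Longrightarrow> \<phi> \<noteq> (\<lambda>_. 0) \<Longrightarrow> l = line \<phi>"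
  by (metis line_eqI projE)

lemma pull_id: "\<phi> \<in> points emb W \<Longrightarrow> pull W (\<lambda>f. f) \<phi> = \<phi>"
  by (auto simp: pull_def points_def)

lemma pull_line_id: "l \<in> proj emb W \<Longrightarrow> pull_line W (\<lambda>f. f) l = l"
  by (metis projE pull_id pull_line_line)

lemma proj_pull:
  assumes "form.subspace W" "linear_form_map W T" "T ` W = W'" "l \<in> proj emb W'"
  shows "pull_line W T l \<in> proj emb W"
proof -
  obtain \<phi> where \<phi>: "l = line \<phi>" "\<phi> \<in> points emb W'" "\<phi> \<noteq> (\<lambda>_. 0)"
    using assms(4) by (rule projE)
  obtain f' where "f' \<in> W'" "\<phi> f' \<noteq> 0"
    using points_nonzero[OF \<phi>(2,3)] by blast
  then obtain f where "f \<in> W" "\<phi> (T f) \<noteq> 0"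
    using assms(3) by blast
  then have "pull W T \<phi> \<noteq> (\<lambda>_. 0)"
    by (auto simp: pull_def fun_eq_iff)
  then show ?thesis
    unfolding \<phi>(1) pull_line_line
    using points_pull[OF assms(1,2) _ \<phi>(2)] assms(3) by (intro proj_lineI) auto
qed

text \<open>A functional on \<open>W'\<close>, being zero elsewhere by normalisation, is determined
  by its pullback along a surjection. Applied to \<open>res_form\<close>, this will give the
  injectivity of \<open>dcp_map\<close>.\<close>

lemma pull_line_inj:
  assumes "T ` W = W'" "l \<in> proj emb W'" "l' \<in> proj emb W'" "pull_line W T l = pull_line W T l'"
  shows "l = l'"
proof -
  have eq: "\<psi> = \<psi>'"
    if "pull W T \<psi> = pull W T \<psi>'" "\<psi> \<in> points emb W'" "\<psi>' \<in> points emb W'" for \<psi> \<psi>'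
  proof
    fix g
    show "\<psi> g = \<psi>' g"
    proof (cases "g \<in> W'")
      case True
      then obtain f where "f \<in> W" "T f = g"
        using assms(1) by blast
      then show ?thesis
        using fun_cong[OF that(1), of f] by (simp add: pull_def)
    qed (use that in \<open>auto simp: points_def\<close>)
  qed
  have sub: "l \<subseteq> l'"
    if l: "l \<in> proj emb W'" "l' \<in> proj emb W'" "pull_line W T l = pull_line W T l'" for l l'
  proof
    fix \<psi>
    assume "\<psi> \<in> l"
    then obtain \<psi>' where "\<psi>' \<in> l'" "pull W T \<psi> = pull W T \<psi>'"
      using l(3) unfolding pull_line_def by blast
    then show "\<psi> \<in> l'"
      using eq proj_mem_points[OF l(1)] proj_mem_points[OF l(2)] \<open>\<psi> \<in> l\<close> by metis
  qed
  then show ?thesis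
    using assms by (simp add: subset_antisym)
qed

section \<open>The Zariski topology of a product of projective spaces\<close>

lemma mproj_D: "p \<in> mproj emb S \<Longrightarrow> Y \<in> S \<Longrightarrow> p Y \<in> proj emb Y"
  by (auto simp: mproj_def)

lemma reps_nonempty:
  assumes "p \<in> mproj emb S"
  shows "\<exists>\<Phi>. \<Phi> \<in> reps S p"
proof -
  have "\<exists>\<phi>. \<phi> \<in> p Y \<and> \<phi> \<noteq> (\<lambda>_. 0)" if "Y \<in> S" for Y
    by (metis assms line_self mproj_D projE that)
  then have "\<exists>\<Phi>. \<forall>Y\<in>S. \<Phi> Y \<in> p Y \<and> \<Phi> Y \<noteq> (\<lambda>_. 0)"
    by (intro bchoice) auto
  then show ?thesis
    by (auto simp: reps_def)
qed

lemma reps_line: "p \<in> mproj emb S \<Longrightarrow> \<Phi> \<in> reps S p \<Longrightarrow> Y \<in> S \<Longrightarrow> p Y = line (\<Phi> Y)"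
  using mproj_D[of p emb S Y] proj_eq_line[of "p Y" emb Y "\<Phi> Y"] by (auto simp: reps_def)

lemma reps_points: "p \<in> mproj emb S \<Longrightarrow> \<Phi> \<in> reps S p \<Longrightarrow> Y \<in> S \<Longrightarrow> \<Phi> Y \<in> points emb Y"
  using mproj_D[of p emb S Y] proj_mem_points[of "p Y" emb Y "\<Phi> Y"] by (auto simp: reps_def)

text \<open>Each representative may be rescaled by its own scalar, and the multidegree records the
  effect. Consequently vanishing of \<open>P\<close> depends on the point only, and one convenient
  representative may stand for all of them.\<close>

lemma multihom_scale:
  assumes "multihom emb S d P" "finite S" "\<And>Y. Y \<in> S \<Longrightarrow> \<Phi>' Y = (\<lambda>f. c Y * \<Phi> Y f)"
  shows "P \<Phi>' = (\<Prod>Y\<in>S. c Y ^ d Y) * P \<Phi>"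
  using assms(1)
proof induction
  case (coord Y f)
  have "(\<Prod>Z\<in>S. c Z ^ (if Z = Y then 1 else 0)) = (\<Prod>Z\<in>S. if Z = Y then c Z else 1)"
    by (intro prod.cong) auto
  also have "\<dots> = c Y"
    using coord assms(2) by (simp add: prod.delta)
  finally show ?case
    using coord assms(3) by simp
next
  case (add d P Q)
  then show ?case
    by (simp add: distrib_left)
next
  case (mult d P e Q)
  then show ?case
    by (simp add: power_add prod.distrib)
qed auto

lemma multihom_reps_iff:
  assumes "multihom emb S d P" "finite S" "p \<in> mproj emb S" "\<Phi> \<in> reps S p" "\<Phi>' \<in> reps S p"
  shows "P \<Phi> = 0 \<longleftrightarrow> P \<Phi>' = 0"
proof -
  have "\<exists>c. c \<noteq> 0 \<and> \<Phi>' Y = (\<lambda>f. c * \<Phi> Y f)" if "Y \<in> S" for Y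
  proof -
    have "\<Phi>' Y \<in> line (\<Phi> Y)" "\<Phi>' Y \<noteq> (\<lambda>_. 0)"
      using assms that reps_line[OF assms(3,4) that] by (auto simp: reps_def)
    then show ?thesis
      unfolding line_def by (cases "\<Phi> Y = (\<lambda>_. 0)") (auto, metis mult_zero_left)
  qed
  then obtain c where c: "\<And>Y. Y \<in> S \<Longrightarrow> c Y \<noteq> 0 \<and> \<Phi>' Y = (\<lambda>f. c Y * \<Phi> Y f)"
    by metis
  then have "P \<Phi>' = (\<Prod>Y\<in>S. c Y ^ d Y) * P \<Phi>"
    using multihom_scale[OF assms(1,2)] by blast
  moreover have "(\<Prod>Y\<in>S. c Y ^ d Y) \<noteq> 0"
    using c assms(2) by auto
  ultimately show ?thesis
    by simp
qed

lemma multihom_nonzero_open: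
  "multihom emb S d P \<Longrightarrow> openin (zariski emb S) {p \<in> mproj emb S. \<forall>\<Phi>\<in>reps S p. P \<Phi> \<noteq> 0}"
  unfolding zariski_def by (intro topology_generated_by_Basis) blast

lemma multihom_one: "field_embedding emb \<Longrightarrow> multihom emb S (\<lambda>_. 0) (\<lambda>_. 1)"
  using multihom.const[of emb S 1] by (simp add: field_embedding_simps)

lemma topspace_zariski:
  assumes "field_embedding emb"
  shows "topspace (zariski emb S) = mproj emb S"
proof
  show "mproj emb S \<subseteq> topspace (zariski emb S)"
    using openin_subset[OF multihom_nonzero_open[OF multihom_one[OF assms]]] by simp
  show "topspace (zariski emb S) \<subseteq> mproj emb S"
    unfolding zariski_def topology_generated_by_topspace by blast
qed

text \<open>The product of two multihomogeneous polynomials is multihomogeneous, so nonvanishing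
  loci are stable under intersection: the generating sets of the topology form a basis and not just
  a subbasis.\<close>

lemma zariski_basis:
  assumes "field_embedding emb" "openin (zariski emb S) N" "p \<in> N"
  shows "\<exists>P d. multihom emb S d P \<and> (\<forall>\<Phi>\<in>reps S p. P \<Phi> \<noteq> 0) \<and>
    {q \<in> mproj emb S. \<forall>\<Phi>\<in>reps S q. P \<Phi> \<noteq> 0} \<subseteq> N"
proof -
  have "generate_topology_on {{p \<in> mproj emb S. \<forall>\<Phi>\<in>reps S p. P \<Phi> \<noteq> 0} | P. \<exists>d. multihom emb S d P} N"
    using assms(2) unfolding zariski_def openin_topology_generated_by_iff .
  then show ?thesis
    using assms(3)
  proof induction
    case (Int N1 N2)
    then obtain P1 d1 P2 d2 where "multihom emb S d1 P1" "multihom emb S d2 P2"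
      and P: "\<forall>\<Phi>\<in>reps S p. P1 \<Phi> \<noteq> 0" "{q \<in> mproj emb S. \<forall>\<Phi>\<in>reps S q. P1 \<Phi> \<noteq> 0} \<subseteq> N1"
        "\<forall>\<Phi>\<in>reps S p. P2 \<Phi> \<noteq> 0" "{q \<in> mproj emb S. \<forall>\<Phi>\<in>reps S q. P2 \<Phi> \<noteq> 0} \<subseteq> N2"
      by blast
    then have "multihom emb S (\<lambda>Z. d1 Z + d2 Z) (\<lambda>\<Phi>. P1 \<Phi> * P2 \<Phi>)"
      by (intro multihom.mult)
    moreover have "\<forall>\<Phi>\<in>reps S p. P1 \<Phi> * P2 \<Phi> \<noteq> 0"
      using P by simp
    moreover have "{q \<in> mproj emb S. \<forall>\<Phi>\<in>reps S q. P1 \<Phi> * P2 \<Phi> \<noteq> 0} \<subseteq> N1 \<inter> N2"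
      using P by auto
    ultimately show ?case
      by blast
  next
    case (UN K)
    then show ?case
      by (meson Union_upper UnionE order_trans)
  qed blast+
qed

text \<open>A closure is described by the equations that hold on the set. The quantifiers over
  representatives are weak on \<open>C\<close> and strong at \<open>p\<close>, which suits explicit
  representatives and is harmless because vanishing does not depend on them.\<close>

lemma zariski_closure_iff:
  assumes "field_embedding emb" "finite S" "C \<subseteq> mproj emb S"
  shows "p \<in> zariski emb S closure_of C \<longleftrightarrow> p \<in> mproj emb S \<and>
    (\<forall>P d. multihom emb S d P \<longrightarrow> (\<forall>q\<in>C. \<exists>\<Phi>\<in>reps S q. P \<Phi> = 0) \<longrightarrow> (\<forall>\<Phi>\<in>reps S p. P \<Phi> = 0))"
    (is "?L \<longleftrightarrow> ?R")
proof
  assume L: ?L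
  then have p: "p \<in> mproj emb S"
    by (simp add: in_closure_of topspace_zariski[OF assms(1)])
  have "P \<Phi> = 0"
    if P: "multihom emb S d P" "\<forall>q\<in>C. \<exists>\<Phi>\<in>reps S q. P \<Phi> = 0" "\<Phi> \<in> reps S p" for P d \<Phi>
  proof (rule ccontr)
    assume "P \<Phi> \<noteq> 0"
    then have "p \<in> {p \<in> mproj emb S. \<forall>\<Phi>\<in>reps S p. P \<Phi> \<noteq> 0}"
      using multihom_reps_iff[OF P(1) assms(2) p P(3)] p by blast
    moreover have "\<And>N. p \<in> N \<Longrightarrow> openin (zariski emb S) N \<Longrightarrow> \<exists>y\<in>C. y \<in> N"
      using L unfolding in_closure_of by blast
    ultimately obtain q where "q \<in> C" "q \<in> {p \<in> mproj emb S. \<forall>\<Phi>\<in>reps S p. P \<Phi> \<noteq> 0}"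
      using multihom_nonzero_open[OF P(1)] by meson
    then have "q \<in> C" "\<forall>\<Phi>\<in>reps S q. P \<Phi> \<noteq> 0"
      by simp_all
    then show False
      using P(2) by blast
  qed
  then show ?R
    using p by blast
next
  assume R: ?R
  have "\<exists>y\<in>C. y \<in> N" if N: "p \<in> N" "openin (zariski emb S) N" for N
  proof -
    obtain P d where P: "multihom emb S d P" "\<forall>\<Phi>\<in>reps S p. P \<Phi> \<noteq> 0"
      "{q \<in> mproj emb S. \<forall>\<Phi>\<in>reps S q. P \<Phi> \<noteq> 0} \<subseteq> N"
      using zariski_basis[OF assms(1) N(2,1)] by blast
    obtain \<Phi> where "\<Phi> \<in> reps S p"
      using reps_nonempty[OF conjunct1[OF R]] ..
    then have "P \<Phi> \<noteq> 0"
      using P(2) by blast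
    then have "\<not> (\<forall>q\<in>C. \<exists>\<Phi>\<in>reps S q. P \<Phi> = 0)"
      using conjunct2[OF R, THEN spec, THEN spec, THEN mp, OF P(1)] \<open>\<Phi> \<in> reps S p\<close> by auto
    then obtain q where "q \<in> C" "\<forall>\<Phi>\<in>reps S q. P \<Phi> \<noteq> 0"
      by auto
    then show ?thesis
      using P(3) assms(3) by auto
  qed
  then show ?L
    unfolding in_closure_of topspace_zariski[OF assms(1)] using conjunct1[OF R] by blast
qed

lemma zariski_closed_zeros:
  assumes "field_embedding emb" "finite S"
    "\<And>i. i \<in> I \<Longrightarrow> \<exists>d. multihom emb S d (P i)"
  shows "closedin (zariski emb S) {p \<in> mproj emb S. \<forall>i\<in>I. \<forall>\<Phi>\<in>reps S p. P i \<Phi> = 0}"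
proof -
  have "mproj emb S - {p \<in> mproj emb S. \<forall>i\<in>I. \<forall>\<Phi>\<in>reps S p. P i \<Phi> = 0} =
    (\<Union>i\<in>I. {p \<in> mproj emb S. \<forall>\<Phi>\<in>reps S p. P i \<Phi> \<noteq> 0})"
  proof -
    have "(\<forall>\<Phi>\<in>reps S p. P i \<Phi> \<noteq> 0) \<longleftrightarrow> \<not> (\<forall>\<Phi>\<in>reps S p. P i \<Phi> = 0)"
      if "p \<in> mproj emb S" "i \<in> I" for p i
      using assms(3)[OF that(2)] multihom_reps_iff[OF _ assms(2) that(1)] reps_nonempty[OF that(1)]
      by blast
    then show ?thesis
      by blast
  qed
  moreover have "openin (zariski emb S) \<dots>"
    using assms(3) multihom_nonzero_open by (intro openin_Union) blast
  ultimately show ?thesis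
    unfolding closedin_def topspace_zariski[OF assms(1)] by auto
qed

text \<open>The \<open>Y\<close>-th coordinate of the image reads the factor
  \<open>\<sigma> Y\<close> of the argument, through the transpose of a linear map
  \<open>T Y\<close>. The surjectivity of \<open>T Y\<close> onto \<open>\<sigma> Y\<close>, assumed
  below, keeps pullbacks of nonzero functionals nonzero, so that there is no locus of
  indeterminacy.\<close>

definition coord_map ::
  "('v \<Rightarrow> 'k::field) set set \<Rightarrow> (('v \<Rightarrow> 'k) set \<Rightarrow> ('v \<Rightarrow> 'k) set) \<Rightarrow>
   (('v \<Rightarrow> 'k) set \<Rightarrow> ('v \<Rightarrow> 'k) \<Rightarrow> ('v \<Rightarrow> 'k)) \<Rightarrow> ('v, 'k) mpoint \<Rightarrow> ('v, 'k) mpoint" where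
  "coord_map S \<sigma> T p = (\<lambda>Y\<in>S. pull_line Y (T Y) (p (\<sigma> Y)))"

context
  fixes emb :: "'k::field \<Rightarrow> complex" and S S' :: "('v \<Rightarrow> 'k) set set"
    and \<sigma> :: "('v \<Rightarrow> 'k) set \<Rightarrow> ('v \<Rightarrow> 'k) set"
    and T :: "('v \<Rightarrow> 'k) set \<Rightarrow> ('v \<Rightarrow> 'k) \<Rightarrow> ('v \<Rightarrow> 'k)"
  assumes emb: "field_embedding emb" and fin: "finite S" "finite S'"
    and T: "\<And>Y. Y \<in> S \<Longrightarrow> form.subspace Y \<and> \<sigma> Y \<in> S' \<and> linear_form_map Y (T Y) \<and> T Y ` Y = \<sigma> Y"
begin

lemma coord_map_mproj: "p \<in> mproj emb S' \<Longrightarrow> coord_map S \<sigma> T p \<in> mproj emb S"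
  unfolding coord_map_def mproj_def
proof (rule PiE_I)
  fix Y
  assume "p \<in> Pi\<^sub>E S' (proj emb)" "Y \<in> S"
  then have "p (\<sigma> Y) \<in> proj emb (\<sigma> Y)"
    using T by blast
  then show "(\<lambda>Y\<in>S. pull_line Y (T Y) (p (\<sigma> Y))) Y \<in> proj emb Y"
    using T[OF \<open>Y \<in> S\<close>] \<open>Y \<in> S\<close> by (auto intro: proj_pull)
qed auto

lemma coord_map_reps:
  assumes "p \<in> mproj emb S'" "\<Phi> \<in> reps S' p"
  shows "(\<lambda>Y. pull Y (T Y) (\<Phi> (\<sigma> Y))) \<in> reps S (coord_map S \<sigma> T p)"
proof -
  have "pull Y (T Y) (\<Phi> (\<sigma> Y)) \<noteq> (\<lambda>_. 0)" if Y: "Y \<in> S" for Y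
  proof -
    have "p (\<sigma> Y) = line (\<Phi> (\<sigma> Y))" "\<Phi> (\<sigma> Y) \<noteq> (\<lambda>_. 0)" "\<Phi> (\<sigma> Y) \<in> points emb (\<sigma> Y)"
      using Y T assms reps_line[OF assms] reps_points[OF assms] by (auto simp: reps_def)
    then obtain g where "g \<in> \<sigma> Y" "\<Phi> (\<sigma> Y) g \<noteq> 0"
      using points_nonzero[of "\<Phi> (\<sigma> Y)" emb "\<sigma> Y"] by metis
    moreover have "g \<in> T Y ` Y"
      using T[OF Y] \<open>g \<in> \<sigma> Y\<close> by simp
    ultimately obtain f where "f \<in> Y" "\<Phi> (\<sigma> Y) (T Y f) \<noteq> 0"
      by auto
    then show ?thesis
      by (auto simp: pull_def fun_eq_iff)
  qed
  then show ?thesis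
    using T assms by (auto simp: reps_def coord_map_def pull_line_def)
qed

text \<open>Several coordinates of the image may read the same factor \<open>Z\<close>, so its new
  degree is the sum of the old degrees over the fibre of \<open>\<sigma>\<close> at
  \<open>Z\<close>.\<close>

lemma multihom_coord_map:
  assumes "multihom emb S d P"
  shows "multihom emb S' (\<lambda>Z. \<Sum>Y\<in>{Y \<in> S. \<sigma> Y = Z}. d Y)
    (\<lambda>\<Phi>. P (\<lambda>Y. pull Y (T Y) (\<Phi> (\<sigma> Y))))"
  using assms
proof induction
  case (const c)
  then show ?case
    using multihom.const[of emb S' c] by simp
next
  case (coord Y f)
  have "(\<lambda>Z. \<Sum>Y'\<in>{Y' \<in> S. \<sigma> Y' = Z}. if Y' = Y then 1 else 0) = (\<lambda>Z. if Z = \<sigma> Y then 1 else 0 :: nat)"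
    using coord fin by (auto simp: fun_eq_iff)
  moreover have "T Y f \<in> \<sigma> Y"
    using coord T by blast
  ultimately show ?case
    using multihom.coord[of "\<sigma> Y" S' "T Y f" emb] coord T by (simp add: pull_def)
next
  case (add d P Q)
  then show ?case
    by (intro multihom.add)
next
  case (mult d P e Q)
  then show ?case
    unfolding sum.distrib by (intro multihom.mult)
qed

lemma continuous_coord_map: "continuous_map (zariski emb S') (zariski emb S) (coord_map S \<sigma> T)"
  unfolding zariski_def[of emb S]
proof (rule continuous_on_generated_topo)
  fix N
  assume "N \<in> {{p \<in> mproj emb S. \<forall>\<Phi>\<in>reps S p. P \<Phi> \<noteq> 0} | P. \<exists>d. multihom emb S d P}"
  then obtain P d where N: "N = {p \<in> mproj emb S. \<forall>\<Phi>\<in>reps S p. P \<Phi> \<noteq> 0}" and P: "multihom emb S d P"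
    by blast
  let ?Q = "\<lambda>\<Phi>. P (\<lambda>Y. pull Y (T Y) (\<Phi> (\<sigma> Y)))"
  \<comment> \<open>The transported representative is only one among those of the image point;
    independence of the representative extends the statement to all of them.\<close>
  have "(\<forall>\<Phi>\<in>reps S (coord_map S \<sigma> T p). P \<Phi> \<noteq> 0) \<longleftrightarrow> (\<forall>\<Phi>\<in>reps S' p. ?Q \<Phi> \<noteq> 0)"
    if p: "p \<in> mproj emb S'" for p
    using coord_map_reps[OF p] multihom_reps_iff[OF P fin(1) coord_map_mproj[OF p]]
      reps_nonempty[OF p] by blast
  then have "coord_map S \<sigma> T -` N \<inter> topspace (zariski emb S') =
    {p \<in> mproj emb S'. \<forall>\<Phi>\<in>reps S' p. ?Q \<Phi> \<noteq> 0}"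
    unfolding N topspace_zariski[OF emb] using coord_map_mproj by blast
  then show "openin (zariski emb S') (coord_map S \<sigma> T -` N \<inter> topspace (zariski emb S'))"
    using multihom_nonzero_open[OF multihom_coord_map[OF P]] by simp
next
  have "topspace (zariski emb S) = mproj emb S"
    by (rule topspace_zariski[OF emb])
  then have "\<Union>{{p \<in> mproj emb S. \<forall>\<Phi>\<in>reps S p. P \<Phi> \<noteq> 0} | P. \<exists>d. multihom emb S d P} = mproj emb S"
    by (simp add: zariski_def topology_generated_by_topspace)
  then show "coord_map S \<sigma> T ` topspace (zariski emb S')
    \<subseteq> \<Union>{{p \<in> mproj emb S. \<forall>\<Phi>\<in>reps S p. P \<Phi> \<noteq> 0} | P. \<exists>d. multihom emb S d P}"
    using coord_map_mproj by (auto simp: topspace_zariski[OF emb])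
qed

text \<open>One chart suffices: the components are coordinate functions of the single factor
  \<open>\<sigma> Z\<close>, of degree one in it, on the whole product.\<close>

lemma regular_map_coord_map:
  assumes "D \<subseteq> mproj emb S'" "E \<subseteq> mproj emb S" "coord_map S \<sigma> T ` D \<subseteq> E"
  shows "regular_map emb S' D S E (coord_map S \<sigma> T)"
  unfolding regular_map_def
proof (intro conjI ballI)
  fix p Z
  assume "p \<in> D" and Z: "Z \<in> S"
  show "\<exists>N d F. openin (zariski emb S') N \<and> p \<in> N \<and> (\<forall>f\<in>Z. multihom emb S' d (F f)) \<and>
    (\<forall>q\<in>N \<inter> D. \<forall>\<Phi>\<in>reps S' q. coord_map S \<sigma> T q Z = line (\<lambda>f. if f \<in> Z then F f \<Phi> else 0))"
  proof (intro exI conjI ballI)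
    show "openin (zariski emb S') (mproj emb S')"
      using openin_topspace[of "zariski emb S'"] by (simp add: topspace_zariski[OF emb])
    show "p \<in> mproj emb S'"
      using \<open>p \<in> D\<close> assms by blast
    fix f
    assume "f \<in> Z"
    then show "multihom emb S' (\<lambda>Y. if Y = \<sigma> Z then 1 else 0) (\<lambda>\<Phi>. \<Phi> (\<sigma> Z) (T Z f))"
      using T[OF Z] by (intro multihom.coord) auto
  next
    fix q \<Phi>
    assume "q \<in> mproj emb S' \<inter> D" "\<Phi> \<in> reps S' q"
    then have "q (\<sigma> Z) = line (\<Phi> (\<sigma> Z))"
      using T[OF Z] by (intro reps_line) auto
    then show "coord_map S \<sigma> T q Z = line (\<lambda>f. if f \<in> Z then \<Phi> (\<sigma> Z) (T Z f) else 0)"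
      using Z by (simp add: coord_map_def pull_line_line) (simp add: pull_def)
  qed
qed (use assms in auto)

end

section \<open>Irreducible subsets of a topological space\<close>

lemma irreducible_in_finite_cover:
  assumes "irreducible_in X C" "finite F" "\<And>D. D \<in> F \<Longrightarrow> closedin X D" "C \<subseteq> \<Union>F"
  shows "\<exists>D\<in>F. C \<subseteq> D"
  using assms(2-4)
proof (induction F)
  case empty
  then show ?case
    using assms(1) by (auto simp: irreducible_in_def)
next
  case (insert D F)
  have "closedin X (\<Union>F)"
    using insert by (intro closedin_Union) auto
  then have "C \<subseteq> D \<or> C \<subseteq> \<Union>F"
    using assms(1) insert.prems unfolding irreducible_in_def by simp
  then show ?case
    using insert by auto
qed

lemma irreducible_in_closure:
  assumes "irreducible_in X C"
  shows "irreducible_in X (X closure_of C)"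
proof -
  have C: "C \<subseteq> X closure_of C"
    using assms by (intro closure_of_subset) (simp add: irreducible_in_def)
  have "X closure_of C \<subseteq> C1 \<or> X closure_of C \<subseteq> C2"
    if "closedin X C1" "closedin X C2" "X closure_of C \<subseteq> C1 \<union> C2" for C1 C2
  proof -
    have "C \<subseteq> C1 \<or> C \<subseteq> C2"
      using assms C that unfolding irreducible_in_def by blast
    then show ?thesis
      using closure_of_minimal[OF _ that(1)] closure_of_minimal[OF _ that(2)] by metis
  qed
  then show ?thesis
    using assms C closure_of_subset_topspace[of X C] unfolding irreducible_in_def by auto
qed

lemma irreducible_in_image:
  assumes "irreducible_in X C" "continuous_map X Y f"
  shows "irreducible_in Y (f ` C)"
proof -
  have C: "C \<subseteq> topspace X" "C \<noteq> {}"
    using assms(1) by (auto simp: irreducible_in_def)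
  have "f ` C \<subseteq> C1 \<or> f ` C \<subseteq> C2"
    if C12: "closedin Y C1" "closedin Y C2" "f ` C \<subseteq> C1 \<union> C2" for C1 C2
  proof -
    have cl: "closedin X {x \<in> topspace X. f x \<in> C1}" "closedin X {x \<in> topspace X. f x \<in> C2}"
      using closedin_continuous_map_preimage[OF assms(2)] C12 by auto
    have "C \<subseteq> {x \<in> topspace X. f x \<in> C1} \<union> {x \<in> topspace X. f x \<in> C2}"
      using C12 C by auto
    then have "C \<subseteq> {x \<in> topspace X. f x \<in> C1} \<or> C \<subseteq> {x \<in> topspace X. f x \<in> C2}"
      using assms(1) cl unfolding irreducible_in_def by simp
    then show ?thesis
      by auto
  qed
  moreover have "f ` C \<subseteq> topspace Y"
    using C continuous_map_image_subset_topspace[OF assms(2)] by auto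
  ultimately show ?thesis
    using C unfolding irreducible_in_def by simp
qed

text \<open>Sums and products of polynomials in t are polynomials in t. Along such a curve,
  questions about the Zariski topology become questions about the roots of a polynomial in one
  variable.\<close>

lemma multihom_pencil:
  fixes \<Phi> :: "complex \<Rightarrow> ('v \<Rightarrow> 'k::field) set \<Rightarrow> ('v \<Rightarrow> 'k) \<Rightarrow> complex"
  assumes "multihom emb S d P" "\<And>Y f. Y \<in> S \<Longrightarrow> f \<in> Y \<Longrightarrow> \<exists>q. \<forall>t. \<Phi> t Y f = poly q t"
  shows "\<exists>q. \<forall>t. P (\<Phi> t) = poly q t"
  using assms(1)
proof induction
  case (const c)
  show ?case
    by (rule exI[of _ "[:emb c:]"]) simp
next
  case (coord Y f)
  then show ?case
    using assms(2) by blast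
next
  case (add d P Q)
  then obtain q q' where "\<forall>t. P (\<Phi> t) = poly q t" "\<forall>t. Q (\<Phi> t) = poly q' t"
    by blast
  then show ?case
    by (intro exI[of _ "q + q'"]) simp
next
  case (mult d P e Q)
  then obtain q q' where "\<forall>t. P (\<Phi> t) = poly q t" "\<forall>t. Q (\<Phi> t) = poly q' t"
    by blast
  then show ?case
    by (intro exI[of _ "q * q'"]) simp
qed

section \<open>Arrangements with a building set\<close>

text \<open>On points this is the quotient map from V to V/Y^perp.\<close>

abbreviation res :: "('v \<Rightarrow> 'k) set \<Rightarrow> (('v \<Rightarrow> 'k) \<Rightarrow> complex) \<Rightarrow> ('v \<Rightarrow> 'k) \<Rightarrow> complex" where
  "res Y \<equiv> pull Y (\<lambda>f. f)"

section \<open>Linear algebra of spaces of forms\<close>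

lemma ssum_eq_span:
  fixes X Y :: "('v \<Rightarrow> 'k::field) set"
  assumes "form.subspace X" "form.subspace Y"
  shows "ssum X Y = form.span (X \<union> Y)"
proof -
  have span: "form.span X = X" "form.span Y = Y"
    using assms by (simp_all add: form.span_eq_iff)
  show ?thesis
    unfolding form.span_Un span ssum_def by blast
qed

lemma subspace_ssum:
  fixes X Y :: "('v \<Rightarrow> 'k::field) set"
  assumes "form.subspace X" "form.subspace Y"
  shows "form.subspace (ssum X Y)" "X \<subseteq> ssum X Y" "Y \<subseteq> ssum X Y"
    "\<And>Z. form.subspace Z \<Longrightarrow> X \<subseteq> Z \<Longrightarrow> Y \<subseteq> Z \<Longrightarrow> ssum X Y \<subseteq> Z"
proof -
  note eq = ssum_eq_span[OF assms]
  show "form.subspace (ssum X Y)" "X \<subseteq> ssum X Y" "Y \<subseteq> ssum X Y"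
    unfolding eq using form.span_superset[of "X \<union> Y"] by auto
  show "ssum X Y \<subseteq> Z" if "form.subspace Z" "X \<subseteq> Z" "Y \<subseteq> Z" for Z
    unfolding eq using that by (intro form.span_minimal) auto
qed

lemma dim_one_span:
  fixes H :: "('v \<Rightarrow> 'k::field) set"
  assumes "form.subspace H" "form.dim H = 1"
  obtains h where "h \<noteq> 0" "H = form.span {h}"
proof -
  obtain B where B: "B \<subseteq> H" "form.independent B" "H \<subseteq> form.span B" "card B = form.dim H"
    using form.basis_exists by blast
  then obtain h where h: "B = {h}"
    using assms(2) by (auto simp: card_Suc_eq numeral_eq_Suc)
  show thesis
  proof (rule that)
    show "h \<noteq> 0"
      using B(2) form.dependent_zero h by auto
    show "H = form.span {h}"
      using B(1,3) form.span_minimal[OF B(1) assms(1)] h by auto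
  qed
qed

lemma span_singleton_eq:
  fixes h :: "'v \<Rightarrow> 'k::field"
  assumes "f \<in> form.span {h}" "f \<noteq> 0"
  shows "form.span {h} = form.span {f}" "\<exists>c. c \<noteq> 0 \<and> f = fscale c h"
proof -
  obtain c where f: "f = fscale c h"
    using assms(1) by (auto simp: form.span_singleton)
  then have "c \<noteq> 0"
    using assms(2) by (auto simp: fscale_def fun_eq_iff)
  then show "\<exists>c. c \<noteq> 0 \<and> f = fscale c h"
    using f by blast
  have "fscale (1 / c) f = h"
    using \<open>c \<noteq> 0\<close> by (simp add: f fscale_def fun_eq_iff)
  then have "h \<in> form.span {f}"
    unfolding form.span_singleton by (metis rangeI)
  then show "form.span {h} = form.span {f}"
    using assms(1) by (simp add: form.span_minimal subset_antisym)
qed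

text \<open>\<open>direct_sum\<close> is indexed by the set of summands itself, so X \<noteq> Y is
  what makes the sums over \<open>{X, Y}\<close> have two terms.\<close>

lemma decomposition_pair:
  assumes "X \<noteq> Y" "decomposition A Z {X, Y}"
  shows "F \<in> flats A \<Longrightarrow> F \<subseteq> Z \<Longrightarrow> F \<subseteq> ssum (F \<inter> X) (F \<inter> Y)"
    "\<And>f. form.subspace Y \<Longrightarrow> f \<in> X \<Longrightarrow> f \<in> Y \<Longrightarrow> f = 0"
proof -
  assume "F \<in> flats A" "F \<subseteq> Z"
  then have "direct_sum {X, Y} (\<lambda>Z. F \<inter> Z) F"
    using assms(2) by (auto simp: decomposition_def)
  then have F: "F = {\<Sum>i\<in>{X, Y}. g i | g. \<forall>i\<in>{X, Y}. g i \<in> F \<inter> i}"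
    unfolding direct_sum_def by (elim conjE)
  show "F \<subseteq> ssum (F \<inter> X) (F \<inter> Y)"
  proof
    fix f
    assume "f \<in> F"
    then obtain g where "f = (\<Sum>i\<in>{X, Y}. g i)" "\<forall>i\<in>{X, Y}. g i \<in> F \<inter> i"
      by (subst (asm) F) blast
    then show "f \<in> ssum (F \<inter> X) (F \<inter> Y)"
      using assms(1) by (auto simp: ssum_def)
  qed
next
  fix f
  assume f: "form.subspace Y" "f \<in> X" "f \<in> Y"
  have "- f \<in> Y"
    using f form.subspace_neg by blast
  \<comment> \<open>A form common to \<open>X\<close> and \<open>Y\<close> gives the components
    \<open>f\<close> and \<open>- f\<close>, with sum zero; directness makes both vanish.\<close>
  let ?g = "\<lambda>i. if i = X then f else - f"
  have g: "(\<forall>i\<in>{X, Y}. ?g i \<in> i) \<and> (\<Sum>i\<in>{X, Y}. ?g i) = 0"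
    using assms(1) f \<open>- f \<in> Y\<close> by auto
  have "\<forall>g. (\<forall>i\<in>{X, Y}. g i \<in> i) \<and> (\<Sum>i\<in>{X, Y}. g i) = 0 \<longrightarrow> (\<forall>i\<in>{X, Y}. g i = 0)"
    using assms(2) unfolding decomposition_def direct_sum_def by (elim conjE)
  from mp[OF this[THEN spec, of ?g] g] have "\<forall>i\<in>{X, Y}. ?g i = 0" .
  then show "f = 0"
    by auto
qed

text \<open>\<open>U\<close> stands for the dual of V, but \<open>'v\<close> is a bare type here,
  without vector space structure: until the projection of V is constructed, the argument lives in
  spaces of functions on \<open>'v\<close>.\<close>

locale wonderful =
  fixes emb :: "'k::field \<Rightarrow> complex" and U :: "('v \<Rightarrow> 'k) set" and A G :: "('v \<Rightarrow> 'k) set set"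
  assumes emb: "field_embedding emb" and arrangement: "arrangement U A"
    and building_set: "building_set A G" and U_in_G: "U \<in> G"
begin

lemma subspace_U: "form.subspace U"
  using arrangement by (simp add: arrangement_def)

lemma line_in_A:
  assumes "H \<in> A"
  obtains h where "h \<noteq> 0" "H = form.span {h}" "h \<in> U"
proof -
  have H: "H \<subseteq> U" "form.subspace H" "form.dim H = 1"
    using assms arrangement by (auto simp: arrangement_def)
  obtain h where h: "h \<noteq> 0" "H = form.span {h}"
    using dim_one_span[OF H(2,3)] .
  have "h \<in> H"
    unfolding h(2) by (rule form.span_base) simp
  then show thesis
    using that h H(1) by auto
qed

lemma finite_flats: "finite (flats A)"
proof -
  have "flats A = (\<lambda>B. form.span (\<Union>B)) ` Pow A"
    by (auto simp: flats_def)
  then show ?thesis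
    using arrangement by (simp add: arrangement_def)
qed

lemma flat_subspace: "F \<in> flats A \<Longrightarrow> form.subspace F"
  by (auto simp: flats_def)

lemma flat_subset_U:
  assumes "F \<in> flats A"
  shows "F \<subseteq> U"
proof -
  obtain B where B: "B \<subseteq> A" "F = form.span (\<Union>B)"
    using assms by (auto simp: flats_def)
  have "\<Union>B \<subseteq> U"
    using arrangement B(1) by (auto simp: arrangement_def)
  then show ?thesis
    unfolding B(2) using subspace_U by (rule form.span_minimal)
qed

lemma A_subset_flats:
  assumes "H \<in> A"
  shows "H \<in> flats A"
proof -
  have "form.subspace H"
    using assms arrangement by (simp add: arrangement_def)
  then have "H = form.span (\<Union>{H})"
    unfolding ccpo_Sup_singleton by (metis form.span_eq_iff)
  then show ?thesis
    using assms unfolding flats_def by blast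
qed

lemma ssum_flat:
  assumes "F \<in> flats A" "F' \<in> flats A"
  shows "ssum F F' \<in> flats A"
proof -
  obtain B B' where B: "B \<subseteq> A" "F = form.span (\<Union>B)" "B' \<subseteq> A" "F' = form.span (\<Union>B')"
    using assms by (auto simp: flats_def)
  have "ssum F F' = form.span (\<Union>(B \<union> B'))"
    unfolding B(2,4) Union_Un_distrib form.span_Un ssum_def by blast
  then show ?thesis
    using B(1,3) unfolding flats_def by blast
qed

lemma flat_contains_line:
  assumes "F \<in> flats A" "F \<noteq> {0}"
  obtains H where "H \<in> A" "H \<subseteq> F"
proof -
  obtain B where B: "B \<subseteq> A" "F = form.span (\<Union>B)"
    using assms(1) by (auto simp: flats_def)
  then obtain H where "H \<in> B"
    using assms(2) by fastforce
  then show thesis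
    using that[of H] B form.span_superset[of "\<Union>B"] by blast
qed

lemma flat_eq_line:
  assumes "F \<in> flats A" "F \<noteq> {0}" "F \<subseteq> H" "H \<in> A"
  shows "F = H"
proof -
  obtain h where h: "h \<noteq> 0" "H = form.span {h}"
    using line_in_A[OF assms(4)] .
  obtain f where f: "f \<in> F" "f \<noteq> 0"
    using assms(2) form.subspace_0[OF flat_subspace[OF assms(1)]] by auto
  then have "H = form.span {f}"
    using span_singleton_eq(1)[of f h] h(2) assms(3) by auto
  also have "\<dots> \<subseteq> F"
    using f flat_subspace[OF assms(1)] by (intro form.span_minimal) auto
  finally show ?thesis
    using assms(3) by auto
qed

text \<open>A nonzero flat inside a line is that line, so a line admits only the trivial
  decomposition and is irreducible; building sets contain the irreducible flats.\<close>

lemma A_subset_G: "A \<subseteq> G"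
proof
  fix H
  assume H: "H \<in> A"
  obtain h where h: "h \<noteq> 0" "H = form.span {h}"
    using line_in_A[OF H] .
  have "h \<in> H"
    unfolding h(2) by (rule form.span_base) simp
  then have nz: "H \<noteq> {0}"
    using h by auto
  have "direct_sum {H} (\<lambda>Z. F \<inter> Z) F" if "F \<subseteq> H" for F
    using that unfolding direct_sum_def by (auto intro: exI[of _ "\<lambda>_. _"])
  moreover have "direct_sum {H} (\<lambda>Z. Z) H"
    unfolding direct_sum_def by (auto intro: exI[of _ "\<lambda>_. _"])
  ultimately have "decomposition A H {H}"
    using nz A_subset_flats[OF H] unfolding decomposition_def by (auto simp: Int_absorb2)
  moreover have "D = {H}" if D: "decomposition A H D" for D
  proof -
    have ds: "H = {\<Sum>i\<in>D. g i | g. \<forall>i\<in>D. g i \<in> i}" "D \<subseteq> flats A - {{0}}" "finite D"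
      using D unfolding decomposition_def direct_sum_def by - (elim conjE, assumption)+
    have "Z = H" if Z: "Z \<in> D" for Z
    proof -
      have "Z \<subseteq> H"
      proof
        fix z
        assume z: "z \<in> Z"
        \<comment> \<open>Setting all other components to zero places each summand inside
          \<open>H\<close>.\<close>
        let ?g = "\<lambda>i. if i = Z then z else 0"
        have "\<forall>i\<in>D. ?g i \<in> i"
          using z ds(2) flat_subspace form.subspace_0 by auto
        moreover have "(\<Sum>i\<in>D. ?g i) = z"
          using Z ds(3) by (simp add: sum.delta)
        ultimately have "z \<in> {\<Sum>i\<in>D. g i | g. \<forall>i\<in>D. g i \<in> i}"
          by (intro CollectI exI[of _ ?g]) simp
        then show "z \<in> H"
          using ds(1) by simp
      qed
      then show ?thesis
        using flat_eq_line H Z ds(2) by blast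
    qed
    moreover have "D \<noteq> {}"
      using ds(1) nz by auto
    ultimately show ?thesis
      by blast
  qed
  ultimately have "irreducible_flat A H"
    unfolding irreducible_flat_def using nz A_subset_flats[OF H] by blast
  then show "H \<in> G"
    using building_set by (simp add: building_set_def)
qed

lemma G_flat: "Y \<in> G \<Longrightarrow> Y \<in> flats A" and G_nonzero: "Y \<in> G \<Longrightarrow> Y \<noteq> {0}"
  using building_set by (auto simp: building_set_def)

lemma G_subspace: "Y \<in> G \<Longrightarrow> form.subspace Y" and G_subset_U: "Y \<in> G \<Longrightarrow> Y \<subseteq> U"
  using G_flat flat_subspace flat_subset_U by blast+

lemma finite_G: "finite G"
  using finite_flats building_set finite_subset unfolding building_set_def by blast

text \<open>The condition on sums in the definition of a building set enters the proof through this
  dichotomy alone. The splitting of flats in the second case is what will force \<open>Y\<close>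
  into the modular complement.\<close>

lemma G_sum_cases:
  assumes "Y \<in> G" "Z \<in> G"
  obtains "ssum Y Z \<in> G"
  | "Y \<inter> Z = {0}" "\<And>F. F \<in> flats A \<Longrightarrow> F \<subseteq> ssum Y Z \<Longrightarrow> F \<subseteq> ssum (F \<inter> Y) (F \<inter> Z)"
proof (cases "ssum Y Z \<in> G")
  case False
  then have dec: "Y \<noteq> Z" "decomposition A (ssum Y Z) {Y, Z}"
    using building_set assms unfolding building_set_def by blast+
  have "Y \<inter> Z = {0}"
    using decomposition_pair(2)[OF dec] assms G_subspace form.subspace_0 by auto
  then show thesis
    using decomposition_pair(1)[OF dec] that(2) by blast
qed (use that in blast)

subsection \<open>Points off the hyperplanes\<close>

text \<open>These are the vectors over the points of \<open>Y_open\<close>. Working with them keeps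
  a representative at hand, as pencils require.\<close>

definition generic :: "(('v \<Rightarrow> 'k) \<Rightarrow> complex) \<Rightarrow> bool" where
  "generic \<phi> \<longleftrightarrow> \<phi> \<in> points emb U \<and> (\<forall>H\<in>A. \<forall>h\<in>H. h \<noteq> 0 \<longrightarrow> \<phi> h \<noteq> 0)"

lemma generic_on_line:
  assumes "\<phi> \<in> points emb U" "H \<in> A" "f \<in> H" "\<phi> f \<noteq> 0" "h \<in> H" "h \<noteq> 0"
  shows "\<phi> h \<noteq> 0"
proof -
  obtain h0 where h0: "H = form.span {h0}" "h0 \<in> U"
    using line_in_A[OF assms(2)] .
  obtain c where c: "c \<noteq> 0" "h = fscale c h0"
    using span_singleton_eq(2)[of h h0] assms h0 by auto
  obtain d where d: "f = fscale d h0"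
    using assms(3) h0(1) by (auto simp: form.span_singleton)
  have "\<phi> h = emb c * \<phi> h0" "\<phi> f = emb d * \<phi> h0"
    using assms(1) h0(2) c d by (auto simp: points_def)
  then show ?thesis
    using assms(4) c(1) field_embedding_simps(6)[OF emb] by simp
qed

text \<open>Every nonzero flat contains a line of the arrangement. So a generic functional restricts
  to a nonzero functional on each member of \<open>G\<close>, and the maps from the open part to the
  factors are defined.\<close>

lemma generic_nonzero_on_flat:
  assumes "generic \<phi>" "F \<in> flats A" "F \<noteq> {0}"
  shows "\<exists>f\<in>F. \<phi> f \<noteq> 0"
proof -
  obtain H where H: "H \<in> A" "H \<subseteq> F"
    using flat_contains_line[OF assms(2,3)] .
  obtain h where h: "h \<noteq> 0" "H = form.span {h}"
    using line_in_A[OF H(1)] .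
  have "h \<in> H"
    unfolding h(2) by (rule form.span_base) simp
  then show ?thesis
    using assms(1) H h(1) unfolding generic_def by blast
qed

lemma generic_res_nonzero:
  assumes "generic \<phi>" "Y \<in> G"
  shows "res Y \<phi> \<noteq> (\<lambda>_. 0)"
proof -
  obtain f where "f \<in> Y" "\<phi> f \<noteq> 0"
    using generic_nonzero_on_flat[OF assms(1) G_flat[OF assms(2)] G_nonzero[OF assms(2)]] by blast
  then show ?thesis
    by (auto simp: pull_def fun_eq_iff)
qed

lemma Y_open_eq: "Y_open emb U A = line ` Collect generic"
proof (intro subset_antisym subsetI)
  fix l
  assume l: "l \<in> Y_open emb U A"
  then have lU: "l \<in> proj emb U"
    by (simp add: Y_open_def)
  obtain \<phi> where \<phi>: "l = line \<phi>" "\<phi> \<in> points emb U" "\<phi> \<noteq> (\<lambda>_. 0)"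
    using projE[OF lU] .
  have "generic \<phi>"
    unfolding generic_def
  proof (intro conjI ballI impI)
    fix H h
    assume H: "H \<in> A" "h \<in> H" "h \<noteq> 0"
    then have "l \<notin> proj_perp emb U H"
      using l by (auto simp: Y_open_def)
    then obtain \<psi> f where "\<psi> \<in> l" "f \<in> H" "\<psi> f \<noteq> 0"
      using lU by (auto simp: proj_perp_def)
    then have "\<phi> f \<noteq> 0"
      by (auto simp: \<phi>(1) line_def)
    then show "\<phi> h \<noteq> 0"
      using generic_on_line \<phi>(2) H \<open>f \<in> H\<close> by blast
  qed (rule \<phi>(2))
  then show "l \<in> line ` Collect generic"
    using \<phi>(1) by blast
next
  fix l
  assume "l \<in> line ` Collect generic"
  then obtain \<phi> where \<phi>: "generic \<phi>" "l = line \<phi>"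
    by blast
  have "\<phi> \<noteq> (\<lambda>_. 0)"
    using generic_nonzero_on_flat[OF \<phi>(1) G_flat[OF U_in_G] G_nonzero[OF U_in_G]] by auto
  then have "l \<in> proj emb U"
    using \<phi> proj_lineI by (auto simp: generic_def)
  moreover have "l \<notin> proj_perp emb U H" if "H \<in> A" for H
  proof -
    have "H \<in> G"
      using A_subset_G that by blast
    then obtain f where "f \<in> H" "\<phi> f \<noteq> 0"
      using generic_nonzero_on_flat[OF \<phi>(1)] G_flat G_nonzero by blast
    then show ?thesis
      using line_self[of \<phi>] by (auto simp: proj_perp_def \<phi>(2))
  qed
  ultimately show "l \<in> Y_open emb U A"
    by (auto simp: Y_open_def)
qed

text \<open>Each of the finitely many lines is tested by one of its nonzero forms. The parameters
  failing there are the roots of a polynomial of degree at most one, which is nonzero because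
  \<alpha> and \<beta> do not both vanish at the form.\<close>

lemma finite_not_generic_pencil:
  assumes "\<alpha> \<in> points emb U" "\<beta> \<in> points emb U"
    "\<And>H h. H \<in> A \<Longrightarrow> h \<in> H \<Longrightarrow> h \<noteq> 0 \<Longrightarrow> \<alpha> h \<noteq> 0 \<or> \<beta> h \<noteq> 0"
  shows "finite {t. \<not> generic (\<lambda>f. \<alpha> f + t * \<beta> f)}"
proof -
  have points: "(\<lambda>f. \<alpha> f + t * \<beta> f) \<in> points emb U" for t
    using assms by (intro points_add points_scale)
  have "\<exists>h\<in>H. h \<noteq> 0" if "H \<in> A" for H
    using line_in_A[OF that] form.span_base[of _ "{_}"] by (metis singletonI)
  then obtain h where h: "\<And>H. H \<in> A \<Longrightarrow> h H \<in> H \<and> h H \<noteq> 0"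
    by metis
  have "{t. \<not> generic (\<lambda>f. \<alpha> f + t * \<beta> f)} \<subseteq> (\<Union>H\<in>A. {t. poly [:\<alpha> (h H), \<beta> (h H):] t = 0})"
  proof
    fix t
    assume "t \<in> {t. \<not> generic (\<lambda>f. \<alpha> f + t * \<beta> f)}"
    then obtain H h' where H: "H \<in> A" "h' \<in> H" "h' \<noteq> 0" "\<alpha> h' + t * \<beta> h' = 0"
      using points by (auto simp: generic_def)
    then have "\<alpha> (h H) + t * \<beta> (h H) = 0"
      using generic_on_line[OF points H(1) _ _ H(2,3), of "h H" t] h[OF H(1)] by blast
    then show "t \<in> (\<Union>H\<in>A. {t. poly [:\<alpha> (h H), \<beta> (h H):] t = 0})"
      using H(1) by auto
  qed
  moreover have "finite (\<Union>H\<in>A. {t. poly [:\<alpha> (h H), \<beta> (h H):] t = 0})"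
  proof (intro finite_UN_I poly_roots_finite)
    show "finite A"
      using arrangement by (simp add: arrangement_def)
    show "[:\<alpha> (h H), \<beta> (h H):] \<noteq> 0" if "H \<in> A" for H
      using assms(3) h that by auto
  qed
  ultimately show ?thesis
    by (rule finite_subset)
qed

lemma ex_not_in_finite: "finite (S :: complex set) \<Longrightarrow> \<exists>t. t \<notin> S"
  using ex_new_if_finite[OF infinite_UNIV_char_0] .

text \<open>The lines are added one at a time. Evaluation at a vector where the new form is nonzero
  is added with a coefficient t; for all but finitely many complex t the result is nonzero on the
  new line and remains nonzero on the earlier ones.\<close>

lemma ex_generic: "\<exists>\<phi>. generic \<phi>"
proof -
  have "finite A"
    using arrangement by (simp add: arrangement_def)
  have "B \<subseteq> A \<Longrightarrow> \<exists>\<phi>\<in>points emb U. \<forall>H\<in>B. \<exists>h\<in>H. \<phi> h \<noteq> 0" if "finite B" for B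
    using that
  proof (induction B)
    case empty
    show ?case
      using points_eval[OF emb subspace_U] by auto
  next
    case (insert H B)
    then obtain \<phi> where \<phi>: "\<phi> \<in> points emb U" "\<forall>H\<in>B. \<exists>h\<in>H. \<phi> h \<noteq> 0"
      by auto
    then obtain g where g: "\<And>H. H \<in> B \<Longrightarrow> g H \<in> H \<and> \<phi> (g H) \<noteq> 0"
      by metis
    obtain h where h: "h \<noteq> 0" "H = form.span {h}" "h \<in> U"
      using line_in_A insert.prems by blast
    obtain v where "h v \<noteq> 0"
      using h(1) by (auto simp: fun_eq_iff)
    define \<theta> where "\<theta> = (\<lambda>f. if f \<in> U then emb (f v) else 0)"
    have \<theta>: "\<theta> \<in> points emb U" "\<theta> h \<noteq> 0"
      using points_eval[OF emb subspace_U, of v] h(3) \<open>h v \<noteq> 0\<close> field_embedding_simps(6)[OF emb]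
      by (auto simp: \<theta>_def)
    have "finite ({t. poly [:\<phi> h, \<theta> h:] t = 0} \<union> (\<Union>H\<in>B. {t. poly [:\<phi> (g H), \<theta> (g H):] t = 0}))"
      using g \<theta> insert.hyps by (intro finite_UnI finite_UN_I poly_roots_finite) auto
    then obtain t where "t \<notin> {t. poly [:\<phi> h, \<theta> h:] t = 0} \<union> (\<Union>H\<in>B. {t. poly [:\<phi> (g H), \<theta> (g H):] t = 0})"
      using ex_not_in_finite by blast
    then have t: "\<phi> h + t * \<theta> h \<noteq> 0" "\<And>H. H \<in> B \<Longrightarrow> \<phi> (g H) + t * \<theta> (g H) \<noteq> 0"
      by auto
    have "h \<in> H"
      unfolding h(2) by (rule form.span_base) simp
    have "\<forall>H'\<in>insert H B. \<exists>f\<in>H'. \<phi> f + t * \<theta> f \<noteq> 0"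
      using t g \<open>h \<in> H\<close> by blast
    then show ?case
      using \<phi>(1) \<theta>(1) by (intro bexI[of _ "\<lambda>f. \<phi> f + t * \<theta> f"] points_add points_scale)
  qed
  then obtain \<phi> where "\<phi> \<in> points emb U" "\<forall>H\<in>A. \<exists>h\<in>H. \<phi> h \<noteq> 0"
    using \<open>finite A\<close> by blast
  then show ?thesis
    using generic_on_line unfolding generic_def by blast
qed

end

context wonderful
begin

subsection \<open>The compactification\<close>

abbreviation Y_image :: "('v, 'k) mpoint set" where
  "Y_image \<equiv> Y_emb G ` Y_open emb U A"

abbreviation Ybar :: "('v, 'k) mpoint set" where
  "Ybar \<equiv> Y_bar emb U A G"

abbreviation Zar :: "('v, 'k) mpoint topology" where
  "Zar \<equiv> zariski emb G"

lemma Y_emb_line: "Y_emb G (line \<phi>) = (\<lambda>Y\<in>G. line (res Y \<phi>))"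
  by (simp add: Y_emb_def pull_line_line)

lemma Y_image_eq: "Y_image = (\<lambda>\<phi>. Y_emb G (line \<phi>)) ` Collect generic"
  by (simp add: Y_open_eq image_image)

lemma generic_points: "generic \<phi> \<Longrightarrow> \<phi> \<in> points emb U"
  by (simp add: generic_def)

lemma points_res: "\<phi> \<in> points emb U \<Longrightarrow> Y \<in> G \<Longrightarrow> res Y \<phi> \<in> points emb Y"
  using points_pull[OF G_subspace linear_form_map_id, of Y U \<phi> emb] G_subset_U by simp

lemma Y_emb_mproj: "generic \<phi> \<Longrightarrow> Y_emb G (line \<phi>) \<in> mproj emb G"
  unfolding Y_emb_line mproj_def
  using generic_res_nonzero points_res generic_points by (auto intro!: proj_lineI)

lemma Y_emb_reps: "generic \<phi> \<Longrightarrow> (\<lambda>Y. res Y \<phi>) \<in> reps G (Y_emb G (line \<phi>))"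
  unfolding Y_emb_line reps_def using generic_res_nonzero line_self by auto

lemma Y_image_mproj: "Y_image \<subseteq> mproj emb G"
  using Y_emb_mproj by (auto simp: Y_image_eq)

lemma topspace_Zar: "topspace Zar = mproj emb G"
  by (rule topspace_zariski[OF emb])

lemma Y_image_subset_Ybar: "Y_image \<subseteq> Ybar"
  unfolding Y_bar_def using Y_image_mproj by (intro closure_of_subset) (simp add: topspace_Zar)

lemma Ybar_mproj: "Ybar \<subseteq> mproj emb G"
  unfolding Y_bar_def using closure_of_subset_topspace[of Zar] by (simp add: topspace_Zar)

lemma closed_Ybar: "closedin Zar Ybar"
  by (simp add: Y_bar_def)

text \<open>Along the curve, an equation of the image is a polynomial in t that vanishes at all but
  finitely many t, hence identically, and in particular at t = 0.\<close>

lemma limit_in_Ybar: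
  assumes "\<And>Y f. Y \<in> G \<Longrightarrow> f \<in> Y \<Longrightarrow> \<exists>q. \<forall>t. \<Phi> t Y f = poly q t"
    "p \<in> mproj emb G" "\<Phi> 0 \<in> reps G p"
    "finite {t. \<not> (\<exists>q\<in>Y_image. \<Phi> t \<in> reps G q)}"
  shows "p \<in> Ybar"
proof -
  have "P \<Psi> = 0"
    if P: "multihom emb G d P" "\<forall>q\<in>Y_image. \<exists>\<Phi>\<in>reps G q. P \<Phi> = 0" "\<Psi> \<in> reps G p" for P d \<Psi>
  proof -
    obtain q where q: "\<And>t. P (\<Phi> t) = poly q t"
      using multihom_pencil[where \<Phi> = \<Phi>, OF P(1) assms(1)] by auto
    have "poly q t = 0" if ex: "\<exists>q\<in>Y_image. \<Phi> t \<in> reps G q" for t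
    proof -
      obtain q' where q': "q' \<in> Y_image" "\<Phi> t \<in> reps G q'"
        using ex by blast
      moreover have "q' \<in> mproj emb G"
        using q'(1) Y_image_mproj by auto
      moreover obtain \<Phi>' where "\<Phi>' \<in> reps G q'" "P \<Phi>' = 0"
        using P(2) q'(1) by auto
      ultimately show ?thesis
        using multihom_reps_iff[OF P(1) finite_G] q by metis
    qed
    then have cover: "UNIV \<subseteq> {t. \<not> (\<exists>q\<in>Y_image. \<Phi> t \<in> reps G q)} \<union> {t. poly q t = 0}"
      by auto
    have "infinite {t. poly q t = 0}"
    proof
      assume "finite {t. poly q t = 0}"
      then have "finite (UNIV :: complex set)"
        using finite_subset[OF cover finite_UnI[OF assms(4)]] by blast
      then show False
        using infinite_UNIV_char_0 by blast
    qed
    then have "q = 0"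
      using poly_roots_finite by auto
    then have "P (\<Phi> 0) = 0"
      using q by simp
    then show ?thesis
      using multihom_reps_iff[OF P(1) finite_G assms(2,3) P(3)] by simp
  qed
  then show ?thesis
    unfolding Y_bar_def zariski_closure_iff[OF emb finite_G Y_image_mproj]
    using assms(2) by auto
qed

text \<open>The limit, for \<open>t\<close> tending to \<open>0\<close>, of the pencil through \<open>\<alpha>\<close> and \<open>\<theta>\<close>: on the factors where
  \<open>\<alpha>\<close> vanishes, only \<open>\<theta>\<close> remains.\<close>
lemma pencil_limit:
  assumes "\<alpha> \<in> points emb U" "generic \<theta>"
  shows "(\<lambda>Y\<in>G. if res Y \<alpha> = (\<lambda>_. 0) then line (res Y \<theta>) else line (res Y \<alpha>)) \<in> Ybar"
    (is "?p \<in> Ybar")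
proof (rule limit_in_Ybar)
  \<comment> \<open>Where \<alpha> vanishes on \<open>Y\<close>, the pencil restricts to t times
    \<theta>. Dividing by t there changes no point for t \<noteq> 0 and leaves a representative that
    is still nonzero at t = 0.\<close>
  let ?\<Phi> = "\<lambda>t Y. if res Y \<alpha> = (\<lambda>_. 0) then res Y \<theta> else res Y (\<lambda>f. \<alpha> f + t * \<theta> f)"
  show "\<exists>q. \<forall>t. ?\<Phi> t Y f = poly q t" if "f \<in> Y" for Y f
    using that
    by (intro exI[of _ "if res Y \<alpha> = (\<lambda>_. 0) then [:\<theta> f:] else [:\<alpha> f, \<theta> f:]"]) (simp add: pull_def)
  have "line (res Y \<theta>) \<in> proj emb Y" if "Y \<in> G" for Y
    using proj_lineI[OF points_res[OF generic_points[OF assms(2)] that] generic_res_nonzero[OF assms(2) that]] .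
  moreover have "line (res Y \<alpha>) \<in> proj emb Y" if "Y \<in> G" "res Y \<alpha> \<noteq> (\<lambda>_. 0)" for Y
    using proj_lineI[OF points_res[OF assms(1) that(1)] that(2)] .
  ultimately show "?p \<in> mproj emb G"
    by (auto simp: mproj_def)
  show "?\<Phi> 0 \<in> reps G ?p"
    using generic_res_nonzero[OF assms(2)] line_self by (auto simp: reps_def)
  have "\<exists>q\<in>Y_image. ?\<Phi> t \<in> reps G q" if t: "generic (\<lambda>f. \<alpha> f + t * \<theta> f)" "t \<noteq> 0" for t
  proof
    let ?\<phi> = "\<lambda>f. \<alpha> f + t * \<theta> f"
    show "Y_emb G (line ?\<phi>) \<in> Y_image"
      using t(1) by (auto simp: Y_image_eq)
    have "res Y \<theta> \<in> line (res Y ?\<phi>)" if "res Y \<alpha> = (\<lambda>_. 0)" for Y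
    proof -
      have "\<alpha> f = 0" if "f \<in> Y" for f
        using fun_cong[OF \<open>res Y \<alpha> = (\<lambda>_. 0)\<close>, of f] that by (simp add: pull_def)
      then have "res Y \<theta> = (\<lambda>f. 1 / t * res Y ?\<phi> f)"
        using t(2) by (auto simp: pull_def fun_eq_iff)
      then show ?thesis
        unfolding line_def by blast
    qed
    then show "?\<Phi> t \<in> reps G (Y_emb G (line ?\<phi>))"
      using generic_res_nonzero[OF assms(2)] generic_res_nonzero[OF t(1)] line_self
      unfolding reps_def Y_emb_line by auto
  qed
  then have "{t. \<not> (\<exists>q\<in>Y_image. ?\<Phi> t \<in> reps G q)} \<subseteq> insert 0 {t. \<not> generic (\<lambda>f. \<alpha> f + t * \<theta> f)}"
    by auto
  moreover have "finite {t. \<not> generic (\<lambda>f. \<alpha> f + t * \<theta> f)}"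
    using finite_not_generic_pencil assms unfolding generic_def by blast
  ultimately show "finite {t. \<not> (\<exists>q\<in>Y_image. ?\<Phi> t \<in> reps G q)}"
    by (meson finite_insert finite_subset)
qed

text \<open>Take a generic point outside each of two closed sets, with a polynomial witnessing this.
  On the pencil joining the points, one polynomial is nonzero at t = 0 and the other at t = 1, so
  some generic parameter avoids the roots of both and gives a point of the image outside the
  union.\<close>

lemma irreducible_Y_image: "irreducible_in Zar Y_image"
proof -
  have "Y_image \<subseteq> C1 \<or> Y_image \<subseteq> C2"
    if C: "closedin Zar C1" "closedin Zar C2" "Y_image \<subseteq> C1 \<union> C2" for C1 C2
  proof (rule ccontr)
    assume "\<not> (Y_image \<subseteq> C1 \<or> Y_image \<subseteq> C2)"
    then obtain \<phi> \<theta> where \<phi>: "generic \<phi>" "Y_emb G (line \<phi>) \<notin> C1"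
      and \<theta>: "generic \<theta>" "Y_emb G (line \<theta>) \<notin> C2"
      by (auto simp: Y_image_eq)
    have basis: "\<exists>P d. multihom emb G d P \<and> P (\<lambda>Y. res Y \<psi>) \<noteq> 0 \<and>
        (\<forall>q\<in>mproj emb G. (\<forall>\<Phi>\<in>reps G q. P \<Phi> \<noteq> 0) \<longrightarrow> q \<notin> C)"
      if "closedin Zar C" "generic \<psi>" "Y_emb G (line \<psi>) \<notin> C" for C \<psi>
    proof -
      have "openin Zar (mproj emb G - C)"
        using that(1) by (simp add: closedin_def topspace_Zar)
      moreover have "Y_emb G (line \<psi>) \<in> mproj emb G - C"
        using that Y_emb_mproj by blast
      ultimately have "\<exists>P d. multihom emb G d P \<and> (\<forall>\<Phi>\<in>reps G (Y_emb G (line \<psi>)). P \<Phi> \<noteq> 0) \<and>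
          {q \<in> mproj emb G. \<forall>\<Phi>\<in>reps G q. P \<Phi> \<noteq> 0} \<subseteq> mproj emb G - C"
        by (rule zariski_basis[OF emb])
      then obtain P d where P: "multihom emb G d P" "\<forall>\<Phi>\<in>reps G (Y_emb G (line \<psi>)). P \<Phi> \<noteq> 0"
        "{q \<in> mproj emb G. \<forall>\<Phi>\<in>reps G q. P \<Phi> \<noteq> 0} \<subseteq> mproj emb G - C"
        by auto
      then show ?thesis
        using Y_emb_reps[OF that(2)] by (intro exI[of _ P] exI[of _ d]) auto
    qed
    obtain P1 d1 where P1: "multihom emb G d1 P1" "P1 (\<lambda>Y. res Y \<phi>) \<noteq> 0"
      "\<forall>q\<in>mproj emb G. (\<forall>\<Phi>\<in>reps G q. P1 \<Phi> \<noteq> 0) \<longrightarrow> q \<notin> C1"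
      using basis[OF C(1) \<phi>] by metis
    obtain P2 d2 where P2: "multihom emb G d2 P2" "P2 (\<lambda>Y. res Y \<theta>) \<noteq> 0"
      "\<forall>q\<in>mproj emb G. (\<forall>\<Phi>\<in>reps G q. P2 \<Phi> \<noteq> 0) \<longrightarrow> q \<notin> C2"
      using basis[OF C(2) \<theta>] by metis
    define \<beta> where "\<beta> f = \<theta> f + - 1 * \<phi> f" for f
    define \<Phi> where "\<Phi> t = (\<lambda>Y. res Y (\<lambda>f. \<phi> f + t * \<beta> f))" for t
    have poly: "\<exists>q. \<forall>t. \<Phi> t Y f = poly q t" if "f \<in> Y" for Y f
      using that by (intro exI[of _ "[:\<phi> f, \<beta> f:]"]) (simp add: \<Phi>_def pull_def)
    obtain q1 where q1: "\<And>t. P1 (\<Phi> t) = poly q1 t"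
      using multihom_pencil[OF P1(1), of \<Phi>] poly by metis
    obtain q2 where q2: "\<And>t. P2 (\<Phi> t) = poly q2 t"
      using multihom_pencil[OF P2(1), of \<Phi>] poly by metis
    have "\<Phi> 0 = (\<lambda>Y. res Y \<phi>)" "\<Phi> 1 = (\<lambda>Y. res Y \<theta>)"
      by (simp_all add: \<Phi>_def \<beta>_def fun_eq_iff)
    then have "poly q1 0 \<noteq> 0" "poly q2 1 \<noteq> 0"
      using P1(2) P2(2) q1 q2 by metis+
    then have "finite ({t. poly q1 t = 0} \<union> {t. poly q2 t = 0})"
      by (intro finite_UnI poly_roots_finite) auto
    moreover have "finite {t. \<not> generic (\<lambda>f. \<phi> f + t * \<beta> f)}"
    proof (rule finite_not_generic_pencil)
      show "\<phi> \<in> points emb U"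
        using \<phi>(1) by (rule generic_points)
      show "\<beta> \<in> points emb U"
        unfolding \<beta>_def using generic_points[OF \<phi>(1)] generic_points[OF \<theta>(1)]
        by (intro points_add points_scale)
      show "\<phi> h \<noteq> 0 \<or> \<beta> h \<noteq> 0" if "H \<in> A" "h \<in> H" "h \<noteq> 0" for H h
        using \<phi>(1) that by (auto simp: generic_def)
    qed
    ultimately obtain t where t: "poly q1 t \<noteq> 0" "poly q2 t \<noteq> 0" "generic (\<lambda>f. \<phi> f + t * \<beta> f)"
      using ex_not_in_finite[OF finite_UnI] by blast
    let ?q = "Y_emb G (line (\<lambda>f. \<phi> f + t * \<beta> f))"
    have q: "?q \<in> mproj emb G" "\<Phi> t \<in> reps G ?q" "?q \<in> Y_image"
      using Y_emb_mproj[OF t(3)] Y_emb_reps[OF t(3)] t(3) by (auto simp: \<Phi>_def Y_image_eq)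
    have "\<forall>\<Psi>\<in>reps G ?q. P1 \<Psi> \<noteq> 0" "\<forall>\<Psi>\<in>reps G ?q. P2 \<Psi> \<noteq> 0"
      using multihom_reps_iff[OF P1(1) finite_G q(1,2)] multihom_reps_iff[OF P2(1) finite_G q(1,2)]
        t(1,2) q1 q2 by metis+
    then have "?q \<notin> C1" "?q \<notin> C2"
      using P1(3) P2(3) q(1) by auto
    then show False
      using C(3) q(3) by auto
  qed
  then show ?thesis
    unfolding irreducible_in_def topspace_Zar using Y_image_mproj ex_generic by (auto simp: Y_open_eq)
qed

lemma irreducible_Ybar: "irreducible_in Zar Ybar"
  unfolding Y_bar_def by (rule irreducible_in_closure[OF irreducible_Y_image])

text \<open>On the image both coordinates are restrictions of one functional, so the 2 by 2 minors
  of their values on \<open>Y\<close> vanish there; these equations persist on the closure.\<close>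

lemma Ybar_compatible:
  assumes "p \<in> Ybar" "\<Phi> \<in> reps G p" "Y \<in> G" "Z \<in> G" "Y \<subseteq> Z" "f \<in> Y" "g \<in> Y"
  shows "\<Phi> Z f * \<Phi> Y g = \<Phi> Z g * \<Phi> Y f"
proof -
  let ?d = "\<lambda>W. (if W = Z then 1 else 0) + (if W = Y then 1 else 0) :: nat"
  \<comment> \<open>Coefficients have to come from \<open>'k\<close>, so the minus sign enters as
    the constant \<open>emb (- 1)\<close>.\<close>
  let ?P = "\<lambda>\<Phi>. \<Phi> Z f * \<Phi> Y g + emb (- 1) * (\<Phi> Z g * \<Phi> Y f)"
  have fg: "f \<in> Z" "g \<in> Z"
    using assms by auto
  have mon: "multihom emb G ?d (\<lambda>\<Phi>. \<Phi> Z f * \<Phi> Y g)" if "f \<in> Y" "g \<in> Y" for f g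
    using assms that by (intro multihom.mult multihom.coord) auto
  have "multihom emb G ?d (\<lambda>\<Phi>. emb (- 1) * (\<Phi> Z g * \<Phi> Y f))"
    using multihom.mult[OF multihom.const mon[OF assms(7,6)], of "- 1"] by simp
  then have P: "multihom emb G ?d ?P"
    using mon[OF assms(6,7)] by (intro multihom.add)
  have "\<forall>q\<in>Y_image. \<exists>\<Phi>\<in>reps G q. ?P \<Phi> = 0"
  proof
    fix q
    assume "q \<in> Y_image"
    then obtain \<phi> where "generic \<phi>" "q = Y_emb G (line \<phi>)"
      by (auto simp: Y_image_eq)
    moreover have "?P (\<lambda>Y. res Y \<phi>) = 0"
      using assms fg field_embedding_simps[OF emb] by (simp add: pull_def)
    ultimately show "\<exists>\<Phi>\<in>reps G q. ?P \<Phi> = 0"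
      using Y_emb_reps by metis
  qed
  then have "?P \<Phi> = 0"
    using conjunct2[OF iffD1[OF zariski_closure_iff[OF emb finite_G Y_image_mproj]
          assms(1)[unfolded Y_bar_def]], THEN spec, THEN spec, THEN mp, OF P] assms(2) by auto
  then show ?thesis
    using field_embedding_simps[OF emb] by simp
qed

text \<open>By the vanishing minors the two coordinates are proportional on \<open>Y\<close>, so a
  \<open>Z\<close>-coordinate that is not identically zero on \<open>Y\<close> determines the
  \<open>Y\<close>-coordinate.\<close>

lemma Ybar_restrict:
  assumes "p \<in> Ybar" "\<Phi> \<in> reps G p" "Y \<in> G" "Z \<in> G" "Y \<subseteq> Z" "f \<in> Y" "\<Phi> Z f \<noteq> 0"
  shows "p Y = line (res Y (\<Phi> Z))"
proof -
  have p: "p \<in> mproj emb G"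
    using assms(1) Ybar_mproj by auto
  have \<Phi>Y: "\<Phi> Y \<in> points emb Y" "\<Phi> Y \<noteq> (\<lambda>_. 0)" "p Y = line (\<Phi> Y)"
    using reps_points[OF p assms(2,3)] reps_line[OF p assms(2,3)] assms(2,3) by (auto simp: reps_def)
  have "\<Phi> Y = (\<lambda>g. \<Phi> Y f / \<Phi> Z f * res Y (\<Phi> Z) g)"
  proof
    fix g
    show "\<Phi> Y g = \<Phi> Y f / \<Phi> Z f * res Y (\<Phi> Z) g"
    proof (cases "g \<in> Y")
      case True
      then show ?thesis
        using Ybar_compatible[OF assms(1-6) True] assms(7) by (simp add: pull_def field_simps)
    next
      case False
      then show ?thesis
        using \<Phi>Y(1) by (simp add: points_def pull_def)
    qed
  qed
  then have "\<Phi> Y \<in> line (res Y (\<Phi> Z))"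
    unfolding line_def by blast
  then show ?thesis
    using line_eqI \<Phi>Y by metis
qed

text \<open>The locus that turns out to be the divisor \<open>D\<^sub>Z\<close>.\<close>
definition stratum :: "('v \<Rightarrow> 'k) set \<Rightarrow> ('v, 'k) mpoint set" where
  "stratum Z = {p \<in> Ybar. \<forall>Y\<in>G. \<not> Y \<subseteq> Z \<longrightarrow> (\<forall>\<Phi>\<in>reps G p. \<forall>f\<in>Y \<inter> Z. \<Phi> Y f = 0)}"

lemma stratumI:
  assumes "p \<in> Ybar"
    "\<And>Y \<Phi> f. Y \<in> G \<Longrightarrow> \<not> Y \<subseteq> Z \<Longrightarrow> \<Phi> \<in> reps G p \<Longrightarrow> f \<in> Y \<Longrightarrow> f \<in> Z \<Longrightarrow> \<Phi> Y f = 0"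
  shows "p \<in> stratum Z"
  unfolding stratum_def using assms(1) by (auto intro: assms(2))

lemma stratumD:
  assumes "p \<in> stratum Z"
  shows "p \<in> Ybar"
    "\<And>Y \<Phi> f. Y \<in> G \<Longrightarrow> \<not> Y \<subseteq> Z \<Longrightarrow> \<Phi> \<in> reps G p \<Longrightarrow> f \<in> Y \<Longrightarrow> f \<in> Z \<Longrightarrow> \<Phi> Y f = 0"
  using assms unfolding stratum_def by simp_all

lemma closed_stratum: "closedin Zar (stratum Z)"
proof -
  let ?I = "SIGMA Y:{Y \<in> G. \<not> Y \<subseteq> Z}. Y \<inter> Z"
  have "closedin Zar {p \<in> mproj emb G. \<forall>i\<in>?I. \<forall>\<Phi>\<in>reps G p. \<Phi> (fst i) (snd i) = 0}"
    by (rule zariski_closed_zeros[OF emb finite_G]) (auto intro!: exI multihom.coord)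
  moreover have "stratum Z = Ybar \<inter> {p \<in> mproj emb G. \<forall>i\<in>?I. \<forall>\<Phi>\<in>reps G p. \<Phi> (fst i) (snd i) = 0}"
    using Ybar_mproj unfolding stratum_def by auto
  ultimately show ?thesis
    using closed_Ybar by (simp add: closedin_Int)
qed

text \<open>A boundary point lies in \<open>D\<^sub>Z\<close> for every maximal \<open>Z \<in> G\<close> on which its image in \<open>\<P>(V)\<close> vanishes.\<close>
lemma boundary_eq: "Ybar - Y_image = (\<Union>Z\<in>G - {U}. stratum Z)"
proof (intro subset_antisym subsetI)
  fix p
  assume p: "p \<in> Ybar - Y_image"
  then have pm: "p \<in> mproj emb G"
    using Ybar_mproj by auto
  obtain \<Phi> where \<Phi>: "\<Phi> \<in> reps G p"
    using reps_nonempty[OF pm] ..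
  let ?\<phi> = "\<Phi> U"
  have \<phi>: "?\<phi> \<in> points emb U" "?\<phi> \<noteq> (\<lambda>_. 0)"
    using reps_points[OF pm \<Phi> U_in_G] \<Phi> U_in_G by (auto simp: reps_def)
  let ?K = "{Y \<in> G. \<forall>f\<in>Y. ?\<phi> f = 0}"
  have "?K \<noteq> {}"
  proof
    \<comment> \<open>If no member of \<open>G\<close> is killed, the \<open>U\<close>-coordinate is
      generic and determines all the other coordinates, so that \<open>p\<close> is not a boundary
      point.\<close>
    assume K: "?K = {}"
    have "?\<phi> h \<noteq> 0" if "H \<in> A" "h \<in> H" "h \<noteq> 0" for H h
    proof -
      have "\<exists>f\<in>H. ?\<phi> f \<noteq> 0"
        using K A_subset_G that(1) by blast
      then show ?thesis
        using generic_on_line[OF \<phi>(1)] that by blast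
    qed
    then have gen: "generic ?\<phi>"
      using \<phi>(1) by (simp add: generic_def)
    have "p = Y_emb G (line ?\<phi>)"
    proof (rule PiE_ext)
      show "p \<in> Pi\<^sub>E G (proj emb)" "Y_emb G (line ?\<phi>) \<in> Pi\<^sub>E G (proj emb)"
        using pm Y_emb_mproj[OF gen] by (simp_all add: mproj_def)
      show "p Y = Y_emb G (line ?\<phi>) Y" if Y: "Y \<in> G" for Y
      proof -
        obtain f where "f \<in> Y" "?\<phi> f \<noteq> 0"
          using K Y by blast
        then show ?thesis
          using Ybar_restrict[OF _ \<Phi> Y U_in_G G_subset_U[OF Y]] p Y by (simp add: Y_emb_line)
      qed
    qed
    then show False
      using p gen by (auto simp: Y_image_eq)
  qed
  moreover have "finite ?K"
    using finite_G by simp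
  ultimately obtain Z where Z: "Z \<in> ?K" "\<forall>Y\<in>?K. Z \<subseteq> Y \<longrightarrow> Z = Y"
    using finite_has_maximal[of ?K] by blast
  have "Z \<noteq> U"
    using Z(1) points_nonzero[OF \<phi>] by auto
  have "\<Phi> Y f = 0" if Y: "Y \<in> G" "\<not> Y \<subseteq> Z" "f \<in> Y" "f \<in> Z" for Y f
  proof -
    have ZG: "Z \<in> G"
      using Z by simp
    note sum = subspace_ssum[OF G_subspace[OF Y(1)] G_subspace[OF ZG]]
    show ?thesis
    proof (rule G_sum_cases[OF Y(1) ZG])
      assume S: "ssum Y Z \<in> G"
      \<comment> \<open>By maximality of \<open>Z\<close> the functional is nonzero on the sum, and
        as it kills \<open>Z\<close>, it is nonzero somewhere on \<open>Y\<close>. Comparison with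
        the \<open>U\<close>-coordinate then forces the \<open>Y\<close>-coordinate to vanish at
        \<open>f\<close>, where the functional vanishes.\<close>
      have "ssum Y Z \<notin> ?K"
        using Z(2) sum(2,3) Y(2) by blast
      then have "\<exists>g\<in>Y. ?\<phi> g \<noteq> 0"
      proof -
        obtain s where s: "s \<in> ssum Y Z" "?\<phi> s \<noteq> 0"
          using \<open>ssum Y Z \<notin> ?K\<close> S by blast
        then obtain y z where yz: "s = y + z" "y \<in> Y" "z \<in> Z"
          by (auto simp: ssum_def)
        then have "?\<phi> s = ?\<phi> y + ?\<phi> z"
          using \<phi>(1) G_subset_U[OF Y(1)] G_subset_U[OF ZG] by (auto simp: points_def)
        then show ?thesis
          using s(2) yz Z(1) by auto
      qed
      then obtain g where g: "g \<in> Y" "?\<phi> g \<noteq> 0"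
        by blast
      have "?\<phi> g * \<Phi> Y f = ?\<phi> f * \<Phi> Y g"
        using p by (intro Ybar_compatible[OF _ \<Phi> Y(1) U_in_G G_subset_U[OF Y(1)] g(1) Y(3)]) simp
      then show ?thesis
        using g(2) Z(1) Y(4) by simp
    next
      assume "Y \<inter> Z = {0}"
      then have "f = 0"
        using Y by auto
      then show ?thesis
        using points_zero[OF G_subspace[OF Y(1)] reps_points[OF pm \<Phi> Y(1)] emb] by simp
    qed
  qed
  then have "\<forall>Y\<in>G. \<not> Y \<subseteq> Z \<longrightarrow> (\<forall>\<Psi>\<in>reps G p. \<forall>f\<in>Y \<inter> Z. \<Psi> Y f = 0)"
    using multihom_reps_iff[OF multihom.coord finite_G pm \<Phi>] by (metis IntD1 IntD2)
  then have "p \<in> stratum Z"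
    using p by (simp add: stratum_def)
  then show "p \<in> (\<Union>Z\<in>G - {U}. stratum Z)"
    using Z(1) \<open>Z \<noteq> U\<close> by auto
next
  fix p
  assume "p \<in> (\<Union>Z\<in>G - {U}. stratum Z)"
  then obtain Z where Z: "Z \<in> G" "Z \<noteq> U" "p \<in> stratum Z"
    by auto
  have "p \<notin> Y_image"
  proof
    assume "p \<in> Y_image"
    then obtain \<phi> where \<phi>: "generic \<phi>" "p = Y_emb G (line \<phi>)"
      by (auto simp: Y_image_eq)
    obtain f where "f \<in> Z" "\<phi> f \<noteq> 0"
      using generic_nonzero_on_flat[OF \<phi>(1) G_flat[OF Z(1)] G_nonzero[OF Z(1)]] by blast
    moreover have "\<not> U \<subseteq> Z"
      using G_subset_U[OF Z(1)] Z(2) by blast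
    moreover have "f \<in> U"
      using \<open>f \<in> Z\<close> G_subset_U[OF Z(1)] by blast
    ultimately have "res U \<phi> f = 0"
      using stratumD(2)[OF Z(3) U_in_G] Y_emb_reps[OF \<phi>(1)] unfolding \<phi>(2)[symmetric] by blast
    then show False
      using \<open>\<phi> f \<noteq> 0\<close> \<open>f \<in> U\<close> by (simp add: pull_def)
  qed
  then show "p \<in> Ybar - Y_image"
    using Z(3) by (simp add: stratum_def)
qed

end

section \<open>The retraction given by a modular complement\<close>

text \<open>Apart from \<open>N_int_X\<close>, the conditions on \<open>N\<close> are those
  maintained while hyperplanes are being intersected. Membership of \<open>N\<close> in
  \<open>G\<close> is then a consequence: it is the case \<open>U\<close> of
  \<open>tau_image_G\<close>.\<close>

locale wonderful_complement = wonderful emb U A G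
  for emb :: "'k::field \<Rightarrow> complex" and U :: "('v \<Rightarrow> 'k) set" and A G :: "('v \<Rightarrow> 'k) set set" +
  fixes X N :: "('v \<Rightarrow> 'k) set"
  assumes X_in_G: "X \<in> G" and X_proper: "X \<noteq> U" and N_flat: "N \<in> flats A"
    and N_int_X: "N \<inter> X = {0}" and N_sum_X: "ssum N X = U"
    and N_flats: "\<And>F. F \<in> flats A \<Longrightarrow> F \<inter> N \<in> flats A"
    and N_modular: "\<And>Y. Y \<in> G \<Longrightarrow> Y \<inter> N \<in> G \<union> {{0}}"
begin

definition tau :: "('v \<Rightarrow> 'k) \<Rightarrow> 'v \<Rightarrow> 'k" where
  "tau f = (THE n. n \<in> N \<and> f - n \<in> X)"

lemma subspace_N: "form.subspace N"
  by (rule flat_subspace[OF N_flat])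

lemma subspace_X: "form.subspace X"
  by (rule G_subspace[OF X_in_G])

lemma X_subset_U: "X \<subseteq> U"
  by (rule G_subset_U[OF X_in_G])

lemma N_subset_U: "N \<subseteq> U"
  by (rule flat_subset_U[OF N_flat])

lemma not_U_subset_X: "\<not> U \<subseteq> X"
  using X_subset_U X_proper by blast

lemma tau_eqI:
  assumes "n \<in> N" "f - n \<in> X"
  shows "tau f = n"
  unfolding tau_def
proof (rule the_equality)
  fix m
  assume m: "m \<in> N \<and> f - m \<in> X"
  have "m - n \<in> N"
    using m assms(1) form.subspace_diff[OF subspace_N] by blast
  moreover have "(f - n) - (f - m) \<in> X"
    using m assms(2) form.subspace_diff[OF subspace_X] by blast
  then have "m - n \<in> X"
    by simp
  ultimately have "m - n \<in> N \<inter> X"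
    by blast
  then show "m = n"
    unfolding N_int_X by simp
qed (use assms in blast)

lemma tau_in_N: "f \<in> U \<Longrightarrow> tau f \<in> N" and diff_tau_in_X: "f \<in> U \<Longrightarrow> f - tau f \<in> X"
proof -
  have "tau f \<in> N \<and> f - tau f \<in> X" if f: "f \<in> U"
  proof -
    obtain n x where nx: "f = n + x" "n \<in> N" "x \<in> X"
      using f unfolding N_sum_X[symmetric] ssum_def by auto
    then have "tau f = n"
      by (intro tau_eqI) simp_all
    then show ?thesis
      using nx by simp
  qed
  then show "f \<in> U \<Longrightarrow> tau f \<in> N" "f \<in> U \<Longrightarrow> f - tau f \<in> X"
    by blast+
qed

lemma linear_tau: "linear_form_map U tau"
  unfolding linear_form_map_def
proof (intro conjI allI ballI)
  fix f g
  assume fg: "f \<in> U" "g \<in> U"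
  have "(f - tau f) + (g - tau g) \<in> X"
    using form.subspace_add[OF subspace_X] diff_tau_in_X fg by blast
  then show "tau (f + g) = tau f + tau g"
    using form.subspace_add[OF subspace_N] tau_in_N fg by (intro tau_eqI) (auto simp: algebra_simps)
next
  fix c f
  assume f: "f \<in> U"
  have "fscale c (f - tau f) \<in> X"
    using form.subspace_scale[OF subspace_X] diff_tau_in_X f by blast
  then show "tau (fscale c f) = fscale c (tau f)"
    using form.subspace_scale[OF subspace_N] tau_in_N f
    by (intro tau_eqI) (auto simp: form.scale_right_diff_distrib)
qed

lemma tau_N: "n \<in> N \<Longrightarrow> tau n = n"
  using form.subspace_0[OF subspace_X] by (intro tau_eqI) simp_all

lemma tau_X: "x \<in> X \<Longrightarrow> tau x = 0"
  using form.subspace_0[OF subspace_N] by (intro tau_eqI) simp_all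

lemma tau_eq_0_iff: "f \<in> U \<Longrightarrow> tau f = 0 \<longleftrightarrow> f \<in> X"
  using diff_tau_in_X tau_X by fastforce

text \<open>Writing the image as an intersection with \<open>N\<close> is what brings modularity to
  bear: it shows the image to be a flat if \<open>Y\<close> is one, and to be zero or in
  \<open>G\<close> if Y + X is in \<open>G\<close>.\<close>

lemma tau_image:
  assumes "form.subspace Y" "Y \<subseteq> U"
  shows "tau ` Y = ssum Y X \<inter> N"
proof (intro subset_antisym subsetI)
  fix n
  assume "n \<in> tau ` Y"
  then obtain y where y: "y \<in> Y" "n = tau y"
    by blast
  then have "y - n \<in> X" "n \<in> N"
    using assms diff_tau_in_X tau_in_N by auto
  moreover have "n = y + - (y - n)"
    by simp
  ultimately show "n \<in> ssum Y X \<inter> N"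
    using y(1) form.subspace_neg[OF subspace_X] unfolding ssum_def by blast
next
  fix n
  assume n: "n \<in> ssum Y X \<inter> N"
  then obtain y x where yx: "n = y + x" "y \<in> Y" "x \<in> X"
    by (auto simp: ssum_def)
  have "y - n \<in> X"
    using form.subspace_neg[OF subspace_X yx(3)] yx(1) by simp
  then have "tau y = n"
    using n by (intro tau_eqI) auto
  then show "n \<in> tau ` Y"
    using yx(2) by blast
qed

text \<open>If Y + X is not in \<open>G\<close>, the flat (Y + X) Int N, which is tau(Y), splits
  into its parts in \<open>Y\<close> and in \<open>X\<close>. The latter is zero since
  \<open>N\<close> meets \<open>X\<close> trivially, so tau(Y) lies in \<open>Y\<close>. Then y -
  tau(y) lies in both \<open>Y\<close> and \<open>X\<close>, hence is zero.\<close>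

lemma sum_X_cases:
  assumes Y: "Y \<in> G"
  obtains "ssum Y X \<in> G" | "Y \<inter> X = {0}" "Y \<subseteq> N"
proof (rule G_sum_cases[OF Y X_in_G])
  assume S: "Y \<inter> X = {0}" "\<And>F. F \<in> flats A \<Longrightarrow> F \<subseteq> ssum Y X \<Longrightarrow> F \<subseteq> ssum (F \<inter> Y) (F \<inter> X)"
  let ?F = "ssum Y X \<inter> N"
  have "?F \<in> flats A"
    using N_flats[OF ssum_flat[OF G_flat[OF Y] G_flat[OF X_in_G]]] .
  then have F: "?F \<subseteq> ssum (?F \<inter> Y) (?F \<inter> X)"
    using S(2) by blast
  have "Y \<subseteq> N"
  proof
    fix y
    assume y: "y \<in> Y"
    then have yU: "y \<in> U"
      using G_subset_U[OF Y] by blast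
    have "tau y \<in> ssum (?F \<inter> Y) (?F \<inter> X)"
      using F tau_image[OF G_subspace[OF Y] G_subset_U[OF Y]] y by blast
    then obtain y' x where yx: "tau y = y' + x" "y' \<in> Y" "x \<in> N" "x \<in> X"
      by (auto simp: ssum_def)
    then have "x = 0"
      using N_int_X by blast
    then have "y - tau y \<in> Y"
      using yx y form.subspace_diff[OF G_subspace[OF Y]] by simp
    then have "y - tau y = 0"
      using S(1) diff_tau_in_X[OF yU] by blast
    then show "y \<in> N"
      using tau_in_N[OF yU] by simp
  qed
  then show thesis
    using S(1) that(2) by blast
qed (use that in blast)

lemma tau_image_G:
  assumes Y: "Y \<in> G" and "\<not> Y \<subseteq> X"
  shows "tau ` Y \<in> G"
proof (rule sum_X_cases[OF Y])
  assume S: "ssum Y X \<in> G"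
  obtain y where y: "y \<in> Y" "y \<notin> X"
    using assms(2) by blast
  \<comment> \<open>This rules out the value {0} that \<open>N_modular\<close> allows.\<close>
  then have "tau y \<noteq> 0"
    using tau_eq_0_iff G_subset_U[OF Y] by blast
  then have "tau ` Y \<noteq> {0}"
    using y(1) by blast
  then show ?thesis
    using N_modular[OF S] tau_image[OF G_subspace[OF Y] G_subset_U[OF Y]] by simp
next
  assume "Y \<subseteq> N"
  then have "tau ` Y = Y"
    using tau_N by force
  then show ?thesis
    using Y by simp
qed

lemma tau_U: "tau ` U = N"
  using tau_in_N tau_N N_subset_U by force

lemma N_in_G: "N \<in> G"
  using tau_image_G[OF U_in_G not_U_subset_X] by (simp add: tau_U)

lemma linear_tau_G: "Y \<in> G \<Longrightarrow> linear_form_map Y tau"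
  using linear_form_map_subset[OF linear_tau] G_subset_U by blast

text \<open>Members of \<open>G\<close> inside \<open>X\<close> are treated apart because
  \<open>tau\<close> kills them: pulling back along it would give the zero functional, which is no
  point of the factor.\<close>

definition source :: "('v \<Rightarrow> 'k) set \<Rightarrow> ('v \<Rightarrow> 'k) set" where
  "source Y = (if Y \<subseteq> X then Y else tau ` Y)"

definition source_map :: "('v \<Rightarrow> 'k) set \<Rightarrow> ('v \<Rightarrow> 'k) \<Rightarrow> 'v \<Rightarrow> 'k" where
  "source_map Y = (if Y \<subseteq> X then (\<lambda>f. f) else tau)"

definition retr :: "('v, 'k) mpoint \<Rightarrow> ('v, 'k) mpoint" where
  "retr = coord_map G source source_map"

lemma source_conditions:
  "Y \<in> G \<Longrightarrow> form.subspace Y \<and> source Y \<in> G \<and> linear_form_map Y (source_map Y) \<and>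
    source_map Y ` Y = source Y"
  using G_subspace tau_image_G linear_tau_G linear_form_map_id
  by (auto simp: source_def source_map_def)

lemma retr_mproj: "p \<in> mproj emb G \<Longrightarrow> retr p \<in> mproj emb G"
  unfolding retr_def by (rule coord_map_mproj[OF emb finite_G finite_G source_conditions])

lemma continuous_retr: "continuous_map Zar Zar retr"
  unfolding retr_def by (rule continuous_coord_map[OF emb finite_G finite_G source_conditions])

lemma regular_retr:
  "D \<subseteq> mproj emb G \<Longrightarrow> E \<subseteq> mproj emb G \<Longrightarrow> retr ` D \<subseteq> E \<Longrightarrow> regular_map emb G D G E retr"
  unfolding retr_def by (rule regular_map_coord_map[OF emb finite_G finite_G source_conditions])

lemma retr_sub: "p \<in> mproj emb G \<Longrightarrow> Y \<in> G \<Longrightarrow> Y \<subseteq> X \<Longrightarrow> retr p Y = p Y"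
  using pull_line_id[OF mproj_D[of p emb G Y]]
  by (simp add: retr_def coord_map_def source_def source_map_def)

lemma retr_not_sub: "Y \<in> G \<Longrightarrow> \<not> Y \<subseteq> X \<Longrightarrow> retr p Y = pull_line Y tau (p (tau ` Y))"
  by (simp add: retr_def coord_map_def source_def source_map_def)

lemma retr_Y_emb:
  assumes "generic \<phi>" "Y \<in> G"
  shows "retr (Y_emb G (line \<phi>)) Y = (if Y \<subseteq> X then line (res Y \<phi>) else line (pull Y tau \<phi>))"
proof (cases "Y \<subseteq> X")
  case True
  then show ?thesis
    using retr_sub[OF Y_emb_mproj[OF assms(1)] assms(2)] assms(2) by (simp add: Y_emb_line)
next
  case False
  then show ?thesis
    using retr_not_sub[OF assms(2)] tau_image_G[OF assms(2)]
    by (simp add: Y_emb_line pull_line_line pull_pull)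
qed

lemma retr_Y_emb_in_Ybar:
  assumes "generic \<phi>"
  shows "retr (Y_emb G (line \<phi>)) \<in> Ybar"
proof -
  let ?\<alpha> = "pull U tau \<phi>"
  have "tau ` U \<subseteq> U"
    using N_subset_U by (simp add: tau_U)
  then have \<alpha>: "?\<alpha> \<in> points emb U"
    using points_pull[OF subspace_U linear_tau] generic_points[OF assms] by blast
  have res_\<alpha>: "res Y ?\<alpha> = pull Y tau \<phi>" if "Y \<in> G" for Y
    using G_subset_U[OF that] by (auto simp: pull_def fun_eq_iff)
  \<comment> \<open>\<open>pencil_limit\<close> distinguishes cases by vanishing on
    \<open>Y\<close>, and \<open>retr\<close> by inclusion in \<open>X\<close>. These agree: for
    \<open>Y\<close> not inside \<open>X\<close>, tau(Y) is in \<open>G\<close>, and a generic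
    functional does not vanish on it.\<close>
  have zero: "pull Y tau \<phi> = (\<lambda>_. 0) \<longleftrightarrow> Y \<subseteq> X" if Y: "Y \<in> G" for Y
  proof
    assume "Y \<subseteq> X"
    then have "\<phi> (tau f) = 0" if "f \<in> Y" for f
      using that tau_X points_zero[OF subspace_U generic_points[OF assms] emb] by (simp add: subset_iff)
    then show "pull Y tau \<phi> = (\<lambda>_. 0)"
      by (simp add: pull_def fun_eq_iff)
  next
    assume 0: "pull Y tau \<phi> = (\<lambda>_. 0)"
    show "Y \<subseteq> X"
    proof (rule ccontr)
      assume "\<not> Y \<subseteq> X"
      with Y have tY: "tau ` Y \<in> G"
        by (rule tau_image_G)
      obtain g where "g \<in> tau ` Y" "\<phi> g \<noteq> 0"
        using generic_nonzero_on_flat[OF assms G_flat[OF tY] G_nonzero[OF tY]] by blast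
      then obtain f where "f \<in> Y" "\<phi> (tau f) \<noteq> 0"
        by blast
      then show False
        using fun_cong[OF 0, of f] by (simp add: pull_def)
    qed
  qed
  have "retr (Y_emb G (line \<phi>)) =
    (\<lambda>Y\<in>G. if res Y ?\<alpha> = (\<lambda>_. 0) then line (res Y \<phi>) else line (res Y ?\<alpha>))"
  proof (rule PiE_ext)
    show "retr (Y_emb G (line \<phi>)) \<in> Pi\<^sub>E G (\<lambda>_. UNIV)"
      using retr_mproj[OF Y_emb_mproj[OF assms]] by (auto simp: mproj_def)
    show "(\<lambda>Y\<in>G. if res Y ?\<alpha> = (\<lambda>_. 0) then line (res Y \<phi>) else line (res Y ?\<alpha>)) \<in> Pi\<^sub>E G (\<lambda>_. UNIV)"
      by simp
  qed (simp add: retr_Y_emb[OF assms] res_\<alpha> zero)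
  then show ?thesis
    using pencil_limit[OF \<alpha> assms] by simp
qed

lemma retr_Ybar: "retr ` Ybar \<subseteq> Ybar"
proof -
  have "retr ` Ybar \<subseteq> Zar closure_of (retr ` Y_image)"
    unfolding Y_bar_def by (rule continuous_map_image_closure_subset[OF continuous_retr])
  also have "\<dots> \<subseteq> Ybar"
    using retr_Y_emb_in_Ybar closed_Ybar by (intro closure_of_minimal) (auto simp: Y_image_eq)
  finally show ?thesis .
qed

text \<open>For \<open>Y\<close> not inside \<open>X\<close> the coordinate is pulled back along
  \<open>tau\<close>, which kills \<open>X\<close>.\<close>

lemma retr_stratum:
  assumes p: "p \<in> Ybar"
  shows "retr p \<in> stratum X"
proof -
  have pm: "p \<in> mproj emb G"
    using p Ybar_mproj by blast
  show ?thesis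
  proof (rule stratumI)
    show "retr p \<in> Ybar"
      using retr_Ybar p by blast
    fix Y \<Phi> f
    assume Y: "Y \<in> G" "\<not> Y \<subseteq> X" "\<Phi> \<in> reps G (retr p)" "f \<in> Y" "f \<in> X"
    have Z: "tau ` Y \<in> G"
      using Y tau_image_G by blast
    have "\<Phi> Y \<in> pull_line Y tau (p (tau ` Y))"
      using Y(3) retr_not_sub[OF Y(1,2)] Y(1) by (auto simp: reps_def)
    then obtain \<psi> where \<psi>: "\<psi> \<in> p (tau ` Y)" "\<Phi> Y = pull Y tau \<psi>"
      by (auto simp: pull_line_def)
    then have "\<psi> 0 = 0"
      using points_zero[OF G_subspace[OF Z] proj_mem_points[OF mproj_D[OF pm Z]] emb] by blast
    then show "\<Phi> Y f = 0"
      using \<psi>(2) tau_X[OF Y(5)] by (simp add: pull_def)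
  qed
qed

text \<open>If \<open>Y + X \<in> G\<close>, a point of the stratum is given on \<open>Y + X\<close> by a form vanishing on \<open>X\<close>, which
  takes the same values at \<open>f\<close> and at \<open>\<tau> f\<close>. Otherwise \<open>\<tau>\<close> is the identity on \<open>Y\<close>.\<close>
lemma retr_id:
  assumes p: "p \<in> stratum X"
  shows "retr p = p"
proof (rule PiE_ext)
  have pY: "p \<in> Ybar"
    using p by (rule stratumD)
  then have pm: "p \<in> mproj emb G"
    using Ybar_mproj by blast
  then show "p \<in> Pi\<^sub>E G (proj emb)" "retr p \<in> Pi\<^sub>E G (proj emb)"
    using retr_mproj by (simp_all add: mproj_def)
  fix Y
  assume Y: "Y \<in> G"
  show "retr p Y = p Y"
  proof (cases "Y \<subseteq> X")
    case True
    then show ?thesis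
      using retr_sub[OF pm Y] by blast
  next
    case False
    have tY: "tau ` Y \<in> G"
      using tau_image_G[OF Y False] .
    show ?thesis
    proof (rule sum_X_cases[OF Y])
      assume "Y \<subseteq> N"
      then have tau: "tau f = f" if "f \<in> Y" for f
        using tau_N that by blast
      then have "tau ` Y = Y"
        by simp
      moreover have "pull_line Y tau (p Y) = pull_line Y (\<lambda>f. f) (p Y)"
        using tau by (rule pull_line_cong)
      ultimately show ?thesis
        using retr_not_sub[OF Y False] pull_line_id[OF mproj_D[OF pm Y]] by simp
    next
      let ?S = "ssum Y X"
      assume S: "?S \<in> G"
      note sum = subspace_ssum[OF G_subspace[OF Y] subspace_X]
      obtain \<Phi> where \<Phi>: "\<Phi> \<in> reps G p"
        using reps_nonempty[OF pm] ..
      let ?\<psi> = "\<Phi> ?S"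
      have \<psi>: "?\<psi> \<in> points emb ?S" "?\<psi> \<noteq> (\<lambda>_. 0)"
        using reps_points[OF pm \<Phi> S] \<Phi> S by (auto simp: reps_def)
      have "\<not> ?S \<subseteq> X"
        using False sum(2) by blast
      then have X0: "?\<psi> x = 0" if "x \<in> X" for x
        using stratumD(2)[OF p S _ \<Phi>] sum(3) that by blast
      have sub: "tau ` Y \<subseteq> ?S"
        using tau_image[OF G_subspace[OF Y] G_subset_U[OF Y]] by blast
      have tau: "?\<psi> (tau f) = ?\<psi> f" if f: "f \<in> Y" for f
      proof -
        have "?\<psi> (f - tau f) = ?\<psi> f - ?\<psi> (tau f)"
          using sub sum(2) f by (intro points_diff[OF emb sum(1) \<psi>(1)]) auto
        moreover have "f - tau f \<in> X"
          using diff_tau_in_X f G_subset_U[OF Y] by blast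
        ultimately show ?thesis
          using X0 by simp
      qed
      \<comment> \<open>\<open>?\<psi>\<close> is nonzero on Y + X and zero on \<open>X\<close>, so
        it is nonzero on \<open>Y\<close>; being invariant under \<open>tau\<close>, it is nonzero
        on tau(Y) as well. Hence it determines the coordinates at both.\<close>
      obtain s where s: "s \<in> ?S" "?\<psi> s \<noteq> 0"
        using points_nonzero[OF \<psi>] by blast
      then obtain y x where yx: "s = y + x" "y \<in> Y" "x \<in> X"
        by (auto simp: ssum_def)
      then have "?\<psi> s = ?\<psi> y + ?\<psi> x"
        using \<psi>(1) sum(2,3) by (auto simp: points_def)
      then have y: "?\<psi> y \<noteq> 0"
        using s(2) X0[OF yx(3)] by simp
      have "p Y = line (res Y ?\<psi>)"
        using Ybar_restrict[OF pY \<Phi> Y S sum(2) yx(2) y] .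
      moreover have "p (tau ` Y) = line (res (tau ` Y) ?\<psi>)"
        using y tau[OF yx(2)] yx(2) by (intro Ybar_restrict[OF pY \<Phi> tY S sub, of "tau y"]) auto
      moreover have "pull Y tau (res (tau ` Y) ?\<psi>) = res Y ?\<psi>"
        using tau by (auto simp: pull_def fun_eq_iff)
      ultimately show ?thesis
        using retr_not_sub[OF Y False] by (simp add: pull_line_line)
    qed
  qed
qed

section \<open>Irreducibility, image in P(V) and incomparability of the strata\<close>

lemma stratum_eq_image: "stratum X = retr ` Ybar"
proof (intro subset_antisym subsetI)
  fix p
  assume "p \<in> stratum X"
  then show "p \<in> retr ` Ybar"
    using retr_id stratumD(1) by (metis image_eqI)
qed (use retr_stratum in auto)

lemma irreducible_stratum: "irreducible_in Zar (stratum X)"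
  unfolding stratum_eq_image by (rule irreducible_in_image[OF irreducible_Ybar continuous_retr])

text \<open>A functional \<alpha> vanishing on \<open>X\<close> equals its composite with
  \<open>tau\<close>, so it is recovered from its restriction to \<open>N\<close>. Retracting a
  point of \<open>Ybar\<close> whose \<open>N\<close>-coordinate is that restriction gives a point
  of the stratum over \<alpha>, and the limit of a pencil through \<alpha> is such a point.\<close>

lemma stratum_image: "(\<lambda>p. p U) ` stratum X = proj_perp emb U X"
proof (intro subset_antisym subsetI)
  fix l
  assume "l \<in> (\<lambda>p. p U) ` stratum X"
  then obtain p where p: "p \<in> stratum X" "l = p U"
    by blast
  then have pm: "p \<in> mproj emb G"
    using Ybar_mproj stratumD(1) by blast
  obtain \<Phi> where \<Phi>: "\<Phi> \<in> reps G p"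
    using reps_nonempty[OF pm] ..
  have l: "l = line (\<Phi> U)"
    using reps_line[OF pm \<Phi> U_in_G] p(2) by simp
  have X0: "\<Phi> U f = 0" if "f \<in> X" for f
    using stratumD(2)[OF p(1) U_in_G not_U_subset_X \<Phi>] that X_subset_U by blast
  show "l \<in> proj_perp emb U X"
  proof -
    have "\<phi> f = 0" if "\<phi> \<in> l" "f \<in> X" for \<phi> f
      using that X0 unfolding l line_def by auto
    moreover have "l \<in> proj emb U"
      using mproj_D[OF pm U_in_G] p(2) by simp
    ultimately show ?thesis
      by (simp add: proj_perp_def)
  qed
next
  fix l
  assume l: "l \<in> proj_perp emb U X"
  then obtain \<alpha> where \<alpha>: "l = line \<alpha>" "\<alpha> \<in> points emb U" "\<alpha> \<noteq> (\<lambda>_. 0)"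
    by (auto simp: proj_perp_def elim: projE)
  have X0: "\<alpha> f = 0" if "f \<in> X" for f
    using l that line_self[of \<alpha>] by (auto simp: proj_perp_def \<alpha>(1))
  have tau: "\<alpha> (tau f) = \<alpha> f" if f: "f \<in> U" for f
  proof -
    have "\<alpha> (f - tau f) = \<alpha> f - \<alpha> (tau f)"
      using tau_in_N[OF f] N_subset_U f by (intro points_diff[OF emb subspace_U \<alpha>(2)]) auto
    then show ?thesis
      using X0 diff_tau_in_X[OF f] by simp
  qed
  have pull: "pull U tau (res N \<alpha>) = \<alpha>"
    using tau tau_in_N \<alpha>(2) by (auto simp: pull_def fun_eq_iff points_def)
  have "res N \<alpha> \<noteq> (\<lambda>_. 0)"
  proof
    assume "res N \<alpha> = (\<lambda>_. 0)"
    then have "\<alpha> = pull U tau (\<lambda>_. 0)"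
      using pull by simp
    then show False
      using \<alpha>(3) by (simp add: pull_def)
  qed
  obtain \<theta> where \<theta>: "generic \<theta>"
    using ex_generic ..
  let ?p = "\<lambda>Y\<in>G. if res Y \<alpha> = (\<lambda>_. 0) then line (res Y \<theta>) else line (res Y \<alpha>)"
  have "retr ?p \<in> stratum X"
    using retr_stratum[OF pencil_limit[OF \<alpha>(2) \<theta>]] .
  moreover have "retr ?p U = l"
    using retr_not_sub[OF U_in_G not_U_subset_X] N_in_G \<open>res N \<alpha> \<noteq> (\<lambda>_. 0)\<close> pull
    by (simp add: tau_U pull_line_line \<alpha>(1))
  ultimately show "l \<in> (\<lambda>p. p U) ` stratum X"
    by blast
qed

text \<open>The retraction keeps the \<open>X\<close>-coordinate, which for a generic point is
  nonzero on \<open>Z\<close>, whereas every point of the stratum of \<open>Z\<close> has an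
  \<open>X\<close>-coordinate vanishing on \<open>Z\<close>.\<close>

lemma stratum_not_subset:
  assumes "Z \<in> G" "Z \<subseteq> X" "Z \<noteq> X"
  shows "\<not> stratum X \<subseteq> stratum Z"
proof
  assume sub: "stratum X \<subseteq> stratum Z"
  obtain \<phi> where \<phi>: "generic \<phi>"
    using ex_generic ..
  let ?p = "retr (Y_emb G (line \<phi>))"
  have "Y_emb G (line \<phi>) \<in> Ybar"
    using \<phi> Y_image_subset_Ybar by (auto simp: Y_image_eq)
  then have p: "?p \<in> stratum Z"
    using retr_stratum sub by blast
  then have pm: "?p \<in> mproj emb G"
    using Ybar_mproj stratumD(1) by blast
  obtain \<Phi> where \<Phi>: "\<Phi> \<in> reps G ?p"
    using reps_nonempty[OF pm] ..
  have "res X \<phi> \<in> line (\<Phi> X)"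
    using reps_line[OF pm \<Phi> X_in_G] retr_Y_emb[OF \<phi> X_in_G] line_self[of "res X \<phi>"] by simp
  moreover have "\<Phi> X f = 0" if "f \<in> Z" for f
    using stratumD(2)[OF p X_in_G _ \<Phi>] assms(2,3) that by blast
  moreover obtain f where "f \<in> Z" "\<phi> f \<noteq> 0"
    using generic_nonzero_on_flat[OF \<phi> G_flat[OF assms(1)] G_nonzero[OF assms(1)]] by blast
  ultimately have "res X \<phi> f = 0"
    by (auto simp: line_def)
  then show False
    using \<open>f \<in> Z\<close> \<open>\<phi> f \<noteq> 0\<close> assms(2) by (auto simp: pull_def)
qed

end

section \<open>The boundary divisors\<close>

text \<open>If \<open>u\<close> were not in the span of \<open>M\<close> and \<open>h\<close>,
  adding both to a basis of \<open>M\<close> would give dim M + 2 independent forms in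
  \<open>U\<close>, one more than its dimension. The finite spanning set \<open>T\<close> makes the
  bases finite, so that cardinalities can be compared.\<close>

lemma hyperplane_complement:
  fixes M U :: "('v \<Rightarrow> 'k::field) set"
  assumes "finite T" "U = form.span T" "form.subspace M" "M \<subseteq> U" "form.dim M + 1 = form.dim U"
    and "h \<in> U" "h \<notin> M" "u \<in> U"
  shows "\<exists>c. u - fscale c h \<in> M"
proof -
  obtain B where B: "B \<subseteq> M" "form.independent B" "M \<subseteq> form.span B" "card B = form.dim M"
    using form.basis_exists by blast
  obtain C where C: "C \<subseteq> U" "form.independent C" "U \<subseteq> form.span C" "card C = form.dim U"
    using form.basis_exists by blast
  have span_B: "form.span B = M"
    using B(1,3) assms(3) form.span_minimal by blast
  have "finite C" "finite B"
    using form.independent_span_bound[OF assms(1)] B(1,2) C(1,2) assms(2,4) by blast+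
  have "h \<notin> B"
    using B(1) assms(7) by blast
  have hB: "form.independent (insert h B)"
    using B(2) assms(7) span_B by (intro form.independent_insertI) auto
  have "u \<in> form.span (insert h B)"
  proof (rule ccontr)
    assume u: "u \<notin> form.span (insert h B)"
    then have "u \<notin> insert h B"
      using form.span_base by blast
    have "form.independent (insert u (insert h B))"
      using u hB by (rule form.independent_insertI)
    moreover have "insert u (insert h B) \<subseteq> form.span C"
      using B(1) C(3) assms(4,6,8) by blast
    ultimately have "card (insert u (insert h B)) \<le> card C"
      using form.independent_span_bound[OF \<open>finite C\<close>] by blast
    moreover have "card (insert u (insert h B)) = card B + 2"
      using \<open>u \<notin> insert h B\<close> \<open>h \<notin> B\<close> \<open>finite B\<close> by simp
    ultimately show False
      using B(4) C(4) assms(5) by linarith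
  qed
  then show ?thesis
    by (simp add: form.span_breakdown_eq span_B)
qed

context wonderful
begin

text \<open>The space of all functions on \<open>'v\<close> may have infinite dimension; the
  finiteness needed for counting dimensions comes from the arrangement, with one generator for each
  line.\<close>

lemma flat_finite_span:
  assumes "F \<in> flats A"
  obtains T where "finite T" "F = form.span T"
proof -
  obtain B where B: "B \<subseteq> A" "F = form.span (\<Union>B)"
    using assms by (auto simp: flats_def)
  have "\<exists>h. H = form.span {h}" if "H \<in> B" for H
    using line_in_A B(1) that by blast
  then obtain h where h: "\<And>H. H \<in> B \<Longrightarrow> H = form.span {h H}"
    by metis
  have "finite (h ` B)"
    using finite_subset[OF B(1)] arrangement by (simp add: arrangement_def)
  moreover have "\<Union>B \<subseteq> form.span (h ` B)"
  proof
    fix f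
    assume "f \<in> \<Union>B"
    then obtain H where H: "H \<in> B" "f \<in> form.span {h H}"
      using h by blast
    then show "f \<in> form.span (h ` B)"
      using form.span_mono[of "{h H}" "h ` B"] by blast
  qed
  then have "F \<subseteq> form.span (h ` B)"
    unfolding B(2) by (intro form.span_minimal) auto
  moreover have "h ` B \<subseteq> \<Union>B"
    using h form.span_base[of "h _" "{h _}"] by blast
  then have "form.span (h ` B) \<subseteq> F"
    unfolding B(2) by (rule form.span_mono)
  ultimately show thesis
    using that by blast
qed

text \<open>Starting from \<open>U\<close>, intersect with \<open>G\<close>-modular hyperplanes, each not containing some line
  of \<open>N \<inter> X\<close>, until \<open>N \<inter> X = 0\<close>.\<close>
lemma ex_modular_complement:
  assumes enough: "enough_G_modular U A G" and X: "X \<in> G" "X \<noteq> U"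
  shows "\<exists>N. wonderful_complement emb U A G X N"
proof -
  define good where "good N \<longleftrightarrow> N \<in> flats A \<and> ssum N X = U \<and> (\<forall>F\<in>flats A. F \<inter> N \<in> flats A) \<and>
    (\<forall>Y\<in>G. Y \<inter> N \<in> G \<union> {{0}})" for N
  have fin: "finite {H \<in> A. H \<subseteq> N \<inter> X}" for N
    using arrangement by (simp add: arrangement_def)
  have step: "\<exists>N'. good N' \<and> N' \<inter> X = {0}" if "good N" for N
    using that
  \<comment> \<open>The number of lines in the intersection drops, because the line \<open>H\<close>
    chosen inside \<open>N \<inter> X\<close> is not inside \<open>M\<close>.\<close>
  proof (induction "card {H \<in> A. H \<subseteq> N \<inter> X}" arbitrary: N rule: less_induct)
    case less
    then have N: "N \<in> flats A" "ssum N X = U" "\<forall>F\<in>flats A. F \<inter> N \<in> flats A"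
      "\<forall>Y\<in>G. Y \<inter> N \<in> G \<union> {{0}}"
      by (auto simp: good_def)
    show ?case
    proof (cases "N \<inter> X = {0}")
      case False
      have "N \<inter> X \<in> flats A"
        using N(3) G_flat[OF X(1)] by (metis Int_commute)
      then obtain H where H: "H \<in> A" "H \<subseteq> N \<inter> X"
        using flat_contains_line False by blast
      obtain M where M: "G_modular A G M" "form.dim M + 1 = form.dim U" "\<not> H \<subseteq> M"
        using enough H(1) unfolding enough_G_modular_def by metis
      have MG: "M \<in> G" and MF: "\<And>F. F \<in> flats A \<Longrightarrow> M \<inter> F \<in> flats A"
        and MY: "\<And>Y. Y \<in> G \<Longrightarrow> Y \<inter> M \<in> G \<union> {{0}}"
        using M(1) by (auto simp: G_modular_def modular_def)
      note subN = flat_subspace[OF N(1)] and subM = G_subspace[OF MG] and subX = G_subspace[OF X(1)]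
      let ?N = "N \<inter> M"
      obtain h where h: "h \<in> H" "h \<notin> M"
        using M(3) by blast
      \<comment> \<open>As \<open>h\<close> lies in both \<open>N\<close> and \<open>X\<close>, a
        multiple of it can be moved from the \<open>N\<close>-part of a form to its
        \<open>X\<close>-part. The right multiple brings the \<open>N\<close>-part into the
        hyperplane \<open>M\<close>.\<close>
      have "U \<subseteq> ssum ?N X"
      proof
        fix u
        assume "u \<in> U"
        then obtain n x where nx: "u = n + x" "n \<in> N" "x \<in> X"
          unfolding N(2)[symmetric] ssum_def by blast
        have "h \<in> U" "n \<in> U"
          using h(1) H(2) G_subset_U[OF X(1)] nx(2) flat_subset_U[OF N(1)] by blast+
        obtain T where "finite T" "U = form.span T"
          using flat_finite_span[OF G_flat[OF U_in_G]] .
        then obtain c where c: "n - fscale c h \<in> M"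
          using hyperplane_complement[OF _ _ subM G_subset_U[OF MG] M(2) \<open>h \<in> U\<close> h(2) \<open>n \<in> U\<close>]
          by blast
        have ch: "fscale c h \<in> N" "fscale c h \<in> X"
          using h(1) H(2) form.subspace_scale subN subX by blast+
        have "n - fscale c h \<in> ?N"
          using c ch(1) nx(2) form.subspace_diff[OF subN] by blast
        moreover have "fscale c h + x \<in> X"
          using ch(2) nx(3) form.subspace_add[OF subX] by blast
        moreover have "u = (n - fscale c h) + (fscale c h + x)"
          by (simp add: nx(1))
        ultimately show "u \<in> ssum ?N X"
          unfolding ssum_def by blast
      qed
      moreover have "ssum ?N X \<subseteq> U"
        using subspace_ssum(4)[OF form.subspace_inter[OF subN subM] subX subspace_U]
          flat_subset_U[OF N(1)] G_subset_U[OF X(1)] by blast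
      moreover have "?N \<in> flats A"
        using MF[OF N(1)] by (simp add: Int_commute)
      moreover have "F \<inter> ?N \<in> flats A" if "F \<in> flats A" for F
        using MF[of "F \<inter> N"] N(3) that by (simp add: Int_ac)
      moreover have "Y \<inter> ?N \<in> G \<union> {{0}}" if "Y \<in> G" for Y
      proof -
        have "Y \<inter> N \<in> G \<or> Y \<inter> N = {0}"
          using N(4) that by blast
        then have "Y \<inter> N \<inter> M \<in> G \<union> {{0}}"
          using MY[of "Y \<inter> N"] form.subspace_0[OF subM] by auto
        then show ?thesis
          by (simp add: Int_assoc)
      qed
      ultimately have "good ?N"
        by (auto simp: good_def)
      moreover have "{H \<in> A. H \<subseteq> ?N \<inter> X} \<subset> {H \<in> A. H \<subseteq> N \<inter> X}"
        using H M(3) by blast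
      then have "card {H \<in> A. H \<subseteq> ?N \<inter> X} < card {H \<in> A. H \<subseteq> N \<inter> X}"
        by (rule psubset_card_mono[OF fin])
      ultimately show ?thesis
        using less.hyps by blast
    qed (use less.prems in blast)
  qed
  have "good U"
  proof -
    have "F \<inter> U = F" if "F \<in> flats A" for F
      using flat_subset_U[OF that] by blast
    moreover have "ssum U X = U"
      using subspace_ssum(2)[OF subspace_U G_subspace[OF X(1)]]
        subspace_ssum(4)[OF subspace_U G_subspace[OF X(1)] subspace_U] G_subset_U[OF X(1)] by blast
    ultimately show ?thesis
      using G_flat U_in_G by (simp add: good_def)
  qed
  from step[OF this] obtain N where "good N" "N \<inter> X = {0}"
    by (elim exE conjE)
  then have N: "N \<in> flats A" "ssum N X = U" "\<And>F. F \<in> flats A \<Longrightarrow> F \<inter> N \<in> flats A"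
    "\<And>Y. Y \<in> G \<Longrightarrow> Y \<inter> N \<in> G \<union> {{0}}" "N \<inter> X = {0}"
    unfolding good_def by blast+
  have "wonderful_complement emb U A G X N"
    by unfold_locales (fact X N)+
  then show ?thesis ..
qed

end

text \<open>A form of \<open>Z\<close> outside \<open>X\<close> has nonzero image under
  \<open>tau\<close>, detected by some v; evaluation at v composed with \<open>tau\<close> kills
  \<open>X\<close> but not this form.\<close>

lemma (in wonderful_complement) proj_perp_subset_D:
  assumes "proj_perp emb U X \<subseteq> proj_perp emb U Z" "Z \<subseteq> U"
  shows "Z \<subseteq> X"
proof (rule ccontr)
  assume "\<not> Z \<subseteq> X"
  then obtain f where f: "f \<in> Z" "f \<notin> X"
    by blast
  then have "tau f \<noteq> 0"
    using tau_eq_0_iff assms(2) by blast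
  then obtain v where v: "tau f v \<noteq> 0"
    by (auto simp: fun_eq_iff)
  let ?e = "\<lambda>g. if g \<in> U then emb (g v) else 0"
  have "tau ` U \<subseteq> U"
    using N_subset_U by (simp add: tau_U)
  then have points: "pull U tau ?e \<in> points emb U"
    using points_pull[OF subspace_U linear_tau] points_eval[OF emb subspace_U] by blast
  have "tau f \<in> U"
    using \<open>tau ` U \<subseteq> U\<close> f(1) assms(2) by blast
  then have ef: "pull U tau ?e f \<noteq> 0"
    using f(1) assms(2) v field_embedding_simps(6)[OF emb] by (auto simp: pull_def)
  have "pull U tau ?e g = 0" if "g \<in> X" for g
    using tau_X[OF that] field_embedding_simps(1)[OF emb] by (simp add: pull_def)
  moreover have "line (pull U tau ?e) \<in> proj emb U"
    using ef by (intro proj_lineI[OF points]) auto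
  ultimately have "line (pull U tau ?e) \<in> proj_perp emb U X"
    unfolding proj_perp_def by (auto simp: line_def)
  then have "line (pull U tau ?e) \<in> proj_perp emb U Z"
    using assms(1) by blast
  then show False
    using ef f(1) line_self[of "pull U tau ?e"] unfolding proj_perp_def by blast
qed

lemma (in wonderful) boundary_divisor_eq:
  assumes enough: "enough_G_modular U A G" and X: "X \<in> G" "X \<noteq> U"
  shows "boundary_divisor emb U A G X = stratum X"
proof -
  have compl: "\<exists>N. wonderful_complement emb U A G Z N" if "Z \<in> G - {U}" for Z
    using ex_modular_complement[OF enough] that by blast
  have irr: "irreducible_in Zar (stratum Z)" if "Z \<in> G - {U}" for Z
    using compl[OF that] wonderful_complement.irreducible_stratum by blast
  have image: "(\<lambda>p. p U) ` stratum Z = proj_perp emb U Z" if "Z \<in> G - {U}" for Z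
    using compl[OF that] wonderful_complement.stratum_image by blast
  have antimono: "Z \<subseteq> Y" if "Y \<in> G - {U}" "Z \<in> G - {U}" "proj_perp emb U Y \<subseteq> proj_perp emb U Z" for Y Z
    using compl[OF that(1)] wonderful_complement.proj_perp_subset_D that G_subset_U by blast
  have XG: "X \<in> G - {U}"
    using X by blast
  have in_stratum: "\<exists>Z\<in>G - {U}. C \<subseteq> stratum Z"
    if C: "irreducible_in Zar C" "C \<subseteq> Ybar - Y_image" for C
  proof -
    have "\<exists>D\<in>stratum ` (G - {U}). C \<subseteq> D"
      using C(2) finite_G closed_stratum unfolding boundary_eq
      by (intro irreducible_in_finite_cover[OF C(1)]) auto
    then show ?thesis
      by simp
  qed
  show ?thesis
    unfolding boundary_divisor_def
  proof (rule the_equality)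
    show "irreducible_component Zar (Ybar - Y_image) (stratum X) \<and>
      (\<lambda>p. p U) ` stratum X = proj_perp emb U X"
      unfolding irreducible_component_def
    proof (intro conjI allI impI)
      show "stratum X \<subseteq> Ybar - Y_image"
        unfolding boundary_eq using XG by blast
      show "irreducible_in Zar (stratum X)"
        using irr[OF XG] .
      show "(\<lambda>p. p U) ` stratum X = proj_perp emb U X"
        using image[OF XG] .
      fix C
      assume C: "stratum X \<subseteq> C" "C \<subseteq> Ybar - Y_image" "irreducible_in Zar C"
      obtain Z where Z: "Z \<in> G - {U}" "C \<subseteq> stratum Z"
        using in_stratum[OF C(3,2)] by (rule bexE)
      have sub: "stratum X \<subseteq> stratum Z"
        using C(1) Z(2) by (rule subset_trans)
      \<comment> \<open>Comparing images in P(V) only gives that \<open>Z\<close> is inside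
        \<open>X\<close>; equality then comes from \<open>stratum_not_subset\<close>.\<close>
      have "proj_perp emb U X \<subseteq> proj_perp emb U Z"
        using image_mono[OF sub, of "\<lambda>p. p U"] by (simp only: image[OF XG] image[OF Z(1)])
      then have "Z \<subseteq> X"
        by (rule antimono[OF XG Z(1)])
      moreover obtain N where "wonderful_complement emb U A G X N"
        using compl[OF XG] ..
      ultimately have "Z = X"
        using wonderful_complement.stratum_not_subset[of emb U A G X N Z] sub Z(1) by blast
      then show "C = stratum X"
        using C(1) Z(2) by simp
    qed
  next
    fix D
    assume D: "irreducible_component Zar (Ybar - Y_image) D \<and> (\<lambda>p. p U) ` D = proj_perp emb U X"
    then have D': "D \<subseteq> Ybar - Y_image" "irreducible_in Zar D"
      "\<And>C. D \<subseteq> C \<Longrightarrow> C \<subseteq> Ybar - Y_image \<Longrightarrow> irreducible_in Zar C \<Longrightarrow> C = D"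
      unfolding irreducible_component_def by simp_all
    obtain Z where Z: "Z \<in> G - {U}" "D \<subseteq> stratum Z"
      using in_stratum[OF D'(2,1)] by (rule bexE)
    \<comment> \<open>The stratum containing the component is itself irreducible, so maximality
      gives equality, and the prescribed image in P(V) determines \<open>Z\<close>.\<close>
    have "stratum Z \<subseteq> Ybar - Y_image"
      unfolding boundary_eq using Z(1) by blast
    then have "stratum Z = D"
      using D'(3)[OF Z(2) _ irr[OF Z(1)]] by simp
    then have "proj_perp emb U Z = proj_perp emb U X"
      using D image[OF Z(1)] by simp
    then have "Z = X"
      using antimono[OF XG Z(1)] antimono[OF Z(1) XG] by simp
    then show "D = stratum X"
      using \<open>stratum Z = D\<close> by simp
  qed
qed

section \<open>The two projections\<close>

lemma Y_bar_mproj: "field_embedding emb \<Longrightarrow> Y_bar emb U A G \<subseteq> mproj emb G"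
  unfolding Y_bar_def using closure_of_subset_topspace by (metis topspace_zariski)

lemma Y_emb_in_Y_bar:
  assumes "field_embedding emb" "l \<in> Y_open emb U A" "Y_emb G l \<in> mproj emb G"
  shows "Y_emb G l \<in> Y_bar emb U A G"
  unfolding Y_bar_def
  using closure_of_subset_Int[of "zariski emb G" "Y_emb G ` Y_open emb U A"] assms
  by (auto simp: topspace_zariski)

text \<open>The coordinates at \<open>Y\<close> inside \<open>X\<close> show the first component as
  it stands, and the other coordinates show the second one through an injective pullback.
  Injectivity allows \<open>dcp_inv\<close> to be evaluated wherever a preimage is known.\<close>

lemma inj_on_dcp_map:
  assumes "B \<subseteq> mproj emb (restr_sub G X)" "C \<subseteq> mproj emb (restr_quot G X)"
  shows "inj_on (dcp_map G X) (B \<times> C)"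
proof (rule inj_onI, clarify)
  fix a b a' b'
  assume "a \<in> B" "b \<in> C" "a' \<in> B" "b' \<in> C" and eq: "dcp_map G X (a, b) = dcp_map G X (a', b')"
  then have a: "a \<in> mproj emb (restr_sub G X)" "a' \<in> mproj emb (restr_sub G X)"
    and b: "b \<in> mproj emb (restr_quot G X)" "b' \<in> mproj emb (restr_quot G X)"
    using assms by auto
  have "a = a'"
  proof (rule PiE_ext)
    show "a \<in> Pi\<^sub>E (restr_sub G X) (proj emb)" "a' \<in> Pi\<^sub>E (restr_sub G X) (proj emb)"
      using a by (simp_all add: mproj_def)
    show "a Y = a' Y" if "Y \<in> restr_sub G X" for Y
      using that fun_cong[OF eq, of Y] by (simp add: dcp_map_def restr_sub_def)
  qed
  moreover have "b = b'"
  proof (rule PiE_ext)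
    show "b \<in> Pi\<^sub>E (restr_quot G X) (proj emb)" "b' \<in> Pi\<^sub>E (restr_quot G X) (proj emb)"
      using b by (simp_all add: mproj_def)
    fix Z
    assume Z: "Z \<in> restr_quot G X"
    then obtain Y where Y: "Z = res_form X ` Y" "Y \<in> G" "\<not> Y \<subseteq> X"
      by (auto simp: restr_quot_def)
    have "pull_line Y (res_form X) (b Z) = pull_line Y (res_form X) (b' Z)"
      using fun_cong[OF eq, of Y] Y by (simp add: dcp_map_def)
    then show "b Z = b' Z"
      using pull_line_inj[OF Y(1)[symmetric] mproj_D[OF b(1) Z] mproj_D[OF b(2) Z]] by blast
  qed
  ultimately show "a = a' \<and> b = b'"
    by blast
qed

lemma res_form_linear: "linear_form_map W (res_form X)"
  by (auto simp: linear_form_map_def res_form_def fscale_def fun_eq_iff)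

lemma linear_form_map_comp: "linear_form_map W (\<lambda>g. g \<circ> \<pi>)"
  by (auto simp: linear_form_map_def fscale_def fun_eq_iff)

lemma subspace_linear_image:
  fixes T :: "('v \<Rightarrow> 'k::field) \<Rightarrow> ('w \<Rightarrow> 'k)"
  assumes "form.subspace W" "linear_form_map W T"
  shows "form.subspace (T ` W)"
proof (rule form.subspaceI)
  have "T (0 + 0) = T 0 + T 0"
    using assms(2) form.subspace_0[OF assms(1)] unfolding linear_form_map_def by blast
  then have "T 0 = 0"
    by simp
  then show "0 \<in> T ` W"
    using form.subspace_0[OF assms(1)] by (metis image_eqI)
  show "f + g \<in> T ` W" if fg: "f \<in> T ` W" "g \<in> T ` W" for f g
  proof -
    obtain x y where xy: "x \<in> W" "f = T x" "y \<in> W" "g = T y"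
      using fg by blast
    then have "f + g = T (x + y)"
      using assms(2) by (simp add: linear_form_map_def)
    then show ?thesis
      using xy form.subspace_add[OF assms(1)] by blast
  qed
  show "fscale c f \<in> T ` W" if f: "f \<in> T ` W" for c f
  proof -
    obtain x where x: "x \<in> W" "f = T x"
      using f by blast
    then have "fscale c f = T (fscale c x)"
      using assms(2) by (simp add: linear_form_map_def)
    then show ?thesis
      using x form.subspace_scale[OF assms(1)] by blast
  qed
qed

context wonderful_complement
begin

lemma sub_point:
  assumes "generic \<phi>"
  shows "line (res X \<phi>) \<in> Y_open emb X (restr_sub A X)"
    "Y_emb (restr_sub G X) (line (res X \<phi>)) \<in> Y_bar emb X (restr_sub A X) (restr_sub G X)"
proof -
  have "line (res X \<phi>) \<in> proj emb X"
    using proj_lineI[OF points_res[OF generic_points[OF assms] X_in_G] generic_res_nonzero[OF assms X_in_G]] .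
  moreover have "line (res X \<phi>) \<notin> proj_perp emb X H" if H: "H \<in> restr_sub A X" for H
  proof -
    have HG: "H \<in> G" "H \<subseteq> X"
      using H A_subset_G by (auto simp: restr_sub_def)
    obtain f where "f \<in> H" "\<phi> f \<noteq> 0"
      using generic_nonzero_on_flat[OF assms G_flat[OF HG(1)] G_nonzero[OF HG(1)]] by blast
    then have "f \<in> H" "res X \<phi> f \<noteq> 0"
      using HG(2) by (auto simp: pull_def)
    then show ?thesis
      using line_self[of "res X \<phi>"] unfolding proj_perp_def by blast
  qed
  ultimately show op: "line (res X \<phi>) \<in> Y_open emb X (restr_sub A X)"
    by (auto simp: Y_open_def)
  have "line (res Y (res X \<phi>)) \<in> proj emb Y" if "Y \<in> restr_sub G X" for Y
  proof -
    have Y: "Y \<in> G" "Y \<subseteq> X"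
      using that by (auto simp: restr_sub_def)
    have "res Y (res X \<phi>) = res Y \<phi>"
      using Y(2) by (auto simp: pull_def fun_eq_iff)
    then show ?thesis
      using proj_lineI[OF points_res[OF generic_points[OF assms] Y(1)] generic_res_nonzero[OF assms Y(1)]] by simp
  qed
  then have "Y_emb (restr_sub G X) (line (res X \<phi>)) \<in> mproj emb (restr_sub G X)"
    by (auto simp: Y_emb_def mproj_def pull_line_line)
  then show "Y_emb (restr_sub G X) (line (res X \<phi>)) \<in> Y_bar emb X (restr_sub A X) (restr_sub G X)"
    by (rule Y_emb_in_Y_bar[OF emb op])
qed

context
  fixes \<pi> :: "'v \<Rightarrow> 'v"
  assumes pi_range: "range \<pi> \<subseteq> perp X" and pi_tau: "\<And>f. f \<in> U \<Longrightarrow> f \<circ> \<pi> = tau f"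
begin

text \<open>\<open>\<pi>\<close> takes its values in X^perp, where a form agrees with its
  restriction. So \<open>tau\<close> factors through V*/X, and composition with \<open>\<pi>\<close>
  carries (Y + X)/X onto tau(Y).\<close>

lemma res_form_comp: "f \<in> U \<Longrightarrow> res_form X f \<circ> \<pi> = tau f"
proof -
  assume f: "f \<in> U"
  have "res_form X f \<circ> \<pi> = f \<circ> \<pi>"
    using pi_range by (auto simp: res_form_def fun_eq_iff)
  then show ?thesis
    using pi_tau[OF f] by simp
qed

lemma comp_image: "Y \<subseteq> U \<Longrightarrow> (\<lambda>g. g \<circ> \<pi>) ` (res_form X ` Y) = tau ` Y"
  unfolding image_image using res_form_comp by (intro image_cong) auto

text \<open>The coordinate at (Y + X)/X is the pullback of the coordinate at tau(Y), a member of
  \<open>G\<close> on which a generic functional is nonzero. The same reasoning for a line of the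
  arrangement shows that the projected point avoids the hyperplanes of the quotient.\<close>

lemma quot_point:
  assumes "generic \<phi>"
  shows "line (pull (res_form X ` U) (\<lambda>f. f \<circ> \<pi>) \<phi>) \<in> Y_open emb (res_form X ` U) (restr_quot A X)"
    "Y_emb (restr_quot G X) (line (pull (res_form X ` U) (\<lambda>f. f \<circ> \<pi>) \<phi>))
      \<in> Y_bar emb (res_form X ` U) (restr_quot A X) (restr_quot G X)"
proof -
  let ?\<alpha> = "pull (res_form X ` U) (\<lambda>f. f \<circ> \<pi>) \<phi>"
  have coord: "line (res (res_form X ` Y) ?\<alpha>) \<in> proj emb (res_form X ` Y)"
    if Y: "Y \<in> G" "\<not> Y \<subseteq> X" for Y
  proof -
    have tY: "tau ` Y \<in> G"
      using tau_image_G[OF Y] .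
    have "line (res (tau ` Y) \<phi>) \<in> proj emb (tau ` Y)"
      using proj_lineI[OF points_res[OF generic_points[OF assms] tY] generic_res_nonzero[OF assms tY]] .
    then have "pull_line (res_form X ` Y) (\<lambda>g. g \<circ> \<pi>) (line (res (tau ` Y) \<phi>)) \<in> proj emb (res_form X ` Y)"
      by (rule proj_pull[OF subspace_linear_image[OF G_subspace[OF Y(1)] res_form_linear]
            linear_form_map_comp comp_image[OF G_subset_U[OF Y(1)]]])
    moreover have "pull (res_form X ` Y) (\<lambda>g. g \<circ> \<pi>) (res (tau ` Y) \<phi>) = res (res_form X ` Y) ?\<alpha>"
      using comp_image[OF G_subset_U[OF Y(1)]] G_subset_U[OF Y(1)] by (auto simp: pull_def fun_eq_iff)
    ultimately show ?thesis
      by (simp add: pull_line_line)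
  qed
  have "res (res_form X ` U) ?\<alpha> = ?\<alpha>"
    by (auto simp: pull_def)
  then have \<alpha>: "line ?\<alpha> \<in> proj emb (res_form X ` U)"
    using coord[OF U_in_G not_U_subset_X] by simp
  have "line ?\<alpha> \<notin> proj_perp emb (res_form X ` U) K" if "K \<in> restr_quot A X" for K
  proof -
    obtain H where H: "K = res_form X ` H" "H \<in> A" "\<not> H \<subseteq> X"
      using \<open>K \<in> restr_quot A X\<close> by (auto simp: restr_quot_def)
    have HG: "H \<in> G"
      using H(2) A_subset_G by blast
    have tH: "tau ` H \<in> G"
      using tau_image_G[OF HG H(3)] .
    obtain g where "g \<in> tau ` H" "\<phi> g \<noteq> 0"
      using generic_nonzero_on_flat[OF assms G_flat[OF tH] G_nonzero[OF tH]] by blast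
    then obtain h where h: "h \<in> H" "\<phi> (tau h) \<noteq> 0"
      by blast
    have "h \<in> U"
      using h(1) G_subset_U[OF HG] by blast
    then have "?\<alpha> (res_form X h) \<noteq> 0" "res_form X h \<in> K"
      using h H(1) res_form_comp by (auto simp: pull_def)
    then show ?thesis
      using line_self[of ?\<alpha>] unfolding proj_perp_def by blast
  qed
  then show op: "line ?\<alpha> \<in> Y_open emb (res_form X ` U) (restr_quot A X)"
    using \<alpha> by (auto simp: Y_open_def)
  have "line (res Z ?\<alpha>) \<in> proj emb Z" if "Z \<in> restr_quot G X" for Z
    using that coord by (auto simp: restr_quot_def)
  then have "Y_emb (restr_quot G X) (line ?\<alpha>) \<in> mproj emb (restr_quot G X)"
    by (auto simp: Y_emb_def mproj_def pull_line_line)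
  then show "Y_emb (restr_quot G X) (line ?\<alpha>) \<in> Y_bar emb (res_form X ` U) (restr_quot A X) (restr_quot G X)"
    by (rule Y_emb_in_Y_bar[OF emb op])
qed

text \<open>For \<open>Y\<close> not inside \<open>X\<close>, restricting forms to X^perp and then
  composing with \<open>\<pi>\<close> is \<open>tau\<close>, so both sides pull back the same
  functional along the same map.\<close>

lemma retr_eq_dcp_map:
  assumes "generic \<phi>"
  shows "retr (Y_emb G (line \<phi>)) = dcp_map G X (Y_emb (restr_sub G X) (line (res X \<phi>)),
    Y_emb (restr_quot G X) (line (pull (res_form X ` U) (\<lambda>f. f \<circ> \<pi>) \<phi>)))"
    (is "_ = dcp_map G X (?a, ?b)")
proof
  fix Y
  show "retr (Y_emb G (line \<phi>)) Y = dcp_map G X (?a, ?b) Y"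
  proof (cases "Y \<in> G")
    case False
    then show ?thesis
      by (simp add: retr_def coord_map_def dcp_map_def)
  next
    case Y: True
    show ?thesis
    proof (cases "Y \<subseteq> X")
      case True
      then have "res Y (res X \<phi>) = res Y \<phi>"
        by (auto simp: pull_def fun_eq_iff)
      then show ?thesis
        using Y True retr_Y_emb[OF assms Y]
        by (simp add: dcp_map_def Y_emb_def restr_sub_def pull_line_line)
    next
      case False
      have Z: "res_form X ` Y \<in> restr_quot G X"
        using Y False by (auto simp: restr_quot_def)
      have "pull Y (res_form X) (res (res_form X ` Y) (pull (res_form X ` U) (\<lambda>f. f \<circ> \<pi>) \<phi>)) = pull Y tau \<phi>"
      proof
        fix f
        show "pull Y (res_form X) (res (res_form X ` Y) (pull (res_form X ` U) (\<lambda>f. f \<circ> \<pi>) \<phi>)) f = pull Y tau \<phi> f"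
        proof (cases "f \<in> Y")
          case True
          then have "f \<in> U"
            using G_subset_U[OF Y] by blast
          then show ?thesis
            using True by (simp add: pull_def res_form_comp)
        qed (simp add: pull_def)
      qed
      then show ?thesis
        using Y False Z retr_Y_emb[OF assms Y] by (simp add: dcp_map_def Y_emb_def pull_line_line)
    qed
  qed
qed

lemma dcp_inv_retr:
  assumes "generic \<phi>"
  shows "dcp_inv emb U A G X (retr (Y_emb G (line \<phi>))) = (Y_emb (restr_sub G X) (line (res X \<phi>)),
    Y_emb (restr_quot G X) (line (pull (res_form X ` U) (\<lambda>f. f \<circ> \<pi>) \<phi>)))"
  unfolding dcp_inv_def retr_eq_dcp_map[OF assms]
  using sub_point(2)[OF assms] quot_point(2)[OF assms]
  by (intro the_inv_into_f_f inj_on_dcp_map[where emb = emb] Y_bar_mproj emb) simp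

end

end

section \<open>Transposing a projection of the dual space\<close>

lemma sum_fun_apply: "(\<Sum>i\<in>I. F i) v = (\<Sum>i\<in>I. F i v)"
  by (induction I rule: infinite_finite_induct) auto

lemma linear_form_map_sum:
  fixes T :: "('v \<Rightarrow> 'k::field) \<Rightarrow> ('w \<Rightarrow> 'k)"
  assumes "form.subspace W" "linear_form_map W T" "\<And>i. i \<in> I \<Longrightarrow> g i \<in> W"
  shows "T (\<Sum>i\<in>I. fscale (c i) (g i)) = (\<Sum>i\<in>I. fscale (c i) (T (g i)))"
proof -
  have "T (0 + 0) = T 0 + T 0"
    using assms(2) form.subspace_0[OF assms(1)] unfolding linear_form_map_def by blast
  then have zero: "T 0 = 0"
    by simp
  show ?thesis
    using assms(3)
  proof (induction I rule: infinite_finite_induct)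
    case (insert i I)
    have "fscale (c j) (g j) \<in> W" if "j \<in> insert i I" for j
      using insert.prems[OF that] by (rule form.subspace_scale[OF assms(1)])
    then have "fscale (c i) (g i) \<in> W" "(\<Sum>i\<in>I. fscale (c i) (g i)) \<in> W"
      by (auto intro: form.subspace_sum[OF assms(1)])
    then have "T (fscale (c i) (g i) + (\<Sum>i\<in>I. fscale (c i) (g i))) =
        fscale (c i) (T (g i)) + T (\<Sum>i\<in>I. fscale (c i) (g i))"
      using assms(2) insert.prems unfolding linear_form_map_def by (metis insertI1)
    then show ?case
      using insert.IH insert.prems by (simp only: sum.insert[OF insert.hyps] insertI2)
  qed (simp_all add: zero)
qed

text \<open>The projection is the transpose of \<open>T\<close>, written in the basis and its dual basis.\<close>
lemma linear_projection_of_dual: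
  fixes smul :: "'k::field \<Rightarrow> 'v::ab_group_add \<Rightarrow> 'v" and Basis :: "'v set"
  assumes V: "finite_dimensional_vector_space smul Basis"
    and sub: "form.subspace (dual smul)"
    and T: "linear_form_map (dual smul) T" "\<And>f. f \<in> dual smul \<Longrightarrow> T f \<in> dual smul"
    and X: "X \<subseteq> dual smul" "\<And>f. f \<in> X \<Longrightarrow> T f = 0" "\<And>f. f \<in> dual smul \<Longrightarrow> f - T f \<in> X"
  shows "\<exists>\<pi>. linear_projection smul (perp X) \<pi> \<and> (\<forall>f\<in>dual smul. f \<circ> \<pi> = T f)"
proof -
  interpret V: finite_dimensional_vector_space smul Basis
    by (rule V)
  have dual_iff: "f \<in> dual smul \<longleftrightarrow> (\<forall>v w. f (v + w) = f v + f w) \<and> (\<forall>c v. f (smul c v) = c * f v)" for f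
    unfolding dual_def Vector_Spaces.linear_iff
    using V.vector_space_axioms vector_space_over_itself.vector_space_axioms by auto
  \<comment> \<open>The coordinate forms of the basis vectors, that is, the dual basis.\<close>
  define e where "e b = (\<lambda>v. V.representation Basis v b)" for b
  have span: "v \<in> V.span Basis" for v
    by (simp add: V.span_Basis)
  have e: "e b \<in> dual smul" for b
    unfolding dual_iff e_def
    by (simp add: V.representation_add[OF V.independent_Basis span span]
        V.representation_scale[OF V.independent_Basis span])
  have expand: "(\<Sum>b\<in>Basis. smul (e b v) b) = v" for v
    unfolding e_def by (rule V.sum_representation_eq[OF V.independent_Basis span V.finite_Basis order_refl])
  have lin_sum: "f (\<Sum>b\<in>B. smul (c b) b) = (\<Sum>b\<in>B. c b * f b)" if "f \<in> dual smul" for f c B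
  proof -
    have "f 0 = 0"
      using that dual_iff[of f] by (metis add_cancel_right_right)
    then show ?thesis
      using that dual_iff[of f] by (induction B rule: infinite_finite_induct) auto
  qed
  \<comment> \<open>The coordinates of the image are prescribed by what transposition demands of the
    dual basis, namely that \<open>e b\<close> composed with \<open>\<pi>\<close> be
    \<open>T (e b)\<close>.\<close>
  define \<pi> where "\<pi> v = (\<Sum>b\<in>Basis. smul (T (e b) v) b)" for v
  have comp: "f \<circ> \<pi> = T f" if f: "f \<in> dual smul" for f
  proof
    fix v
    have "f = (\<Sum>b\<in>Basis. fscale (f b) (e b))"
    proof
      fix w
      have "f w = (\<Sum>b\<in>Basis. e b w * f b)"
        using lin_sum[OF f, of "\<lambda>b. e b w" Basis] by (simp add: expand)
      then show "f w = (\<Sum>b\<in>Basis. fscale (f b) (e b)) w"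
        by (simp add: sum_fun_apply fscale_def mult.commute)
    qed
    then have "T f = (\<Sum>b\<in>Basis. fscale (f b) (T (e b)))"
      using linear_form_map_sum[OF sub T(1), of Basis e f] e by simp
    then have "T f v = (\<Sum>b\<in>Basis. T (e b) v * f b)"
      by (simp add: sum_fun_apply fscale_def mult.commute)
    then show "(f \<circ> \<pi>) v = T f v"
      using lin_sum[OF f] by (simp add: \<pi>_def)
  qed
  have Te: "T (e b) (v + w) = T (e b) v + T (e b) w" "T (e b) (smul c v) = c * T (e b) v" for b v w c
    using T(2)[OF e] dual_iff by blast+
  have "\<pi> (v + w) = \<pi> v + \<pi> w" "\<pi> (smul c v) = smul c (\<pi> v)" for v w c
    by (simp_all add: \<pi>_def Te V.scale_left_distrib sum.distrib V.scale_sum_right)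
  then have "Vector_Spaces.linear smul smul \<pi>"
    unfolding Vector_Spaces.linear_iff using V.vector_space_axioms by blast
  moreover have "\<pi> v \<in> perp X" for v
  proof -
    have "f (\<pi> v) = 0" if "f \<in> X" for f
      using fun_cong[OF comp, of f v] X(1,2) that by auto
    then show ?thesis
      by (simp add: perp_def)
  qed
  \<comment> \<open>The form \<open>e b - T (e b)\<close> lies in \<open>X\<close> and so vanishes
    on X^perp: \<open>\<pi>\<close> preserves every coordinate of \<open>w\<close>.\<close>
  moreover have "\<pi> w = w" if w: "w \<in> perp X" for w
  proof -
    have "T (e b) w = e b w" for b
    proof -
      have "(e b - T (e b)) w = 0"
        using w X(3)[OF e] unfolding perp_def by blast
      then show ?thesis
        by simp
    qed
    then show ?thesis
      by (simp add: \<pi>_def expand)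
  qed
  ultimately have "linear_projection smul (perp X) \<pi>"
    by (auto simp: linear_projection_def)
  then show ?thesis
    using comp by blast
qed

theorem proposition1p5p9:
  fixes smul :: "'k::field \<Rightarrow> 'v::ab_group_add \<Rightarrow> 'v" and Basis :: "'v set"
    and emb :: "'k \<Rightarrow> complex"
    and A G :: "('v \<Rightarrow> 'k) set set" and X :: "('v \<Rightarrow> 'k) set"
  assumes "field_embedding emb"
    and "finite_dimensional_vector_space smul Basis"
    and "arrangement (dual smul) A"
    and "essential (dual smul) A"
    and "building_set A G" and "dual smul \<in> G"
    and "enough_G_modular (dual smul) A G"
    and "X \<in> G" and "X \<noteq> dual smul"
  shows "\<exists>r \<pi>.
    regular_map emb G (Y_bar emb (dual smul) A G)
      G (boundary_divisor emb (dual smul) A G X) r \<and>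
    (\<forall>p\<in>boundary_divisor emb (dual smul) A G X. r p = p) \<and>
    (\<forall>l\<in>Y_open emb (dual smul) A.
       pull_line X (\<lambda>f. f) l \<in> Y_open emb X (restr_sub A X) \<and>
       fst (dcp_inv emb (dual smul) A G X (r (Y_emb G l))) =
         Y_emb (restr_sub G X) (pull_line X (\<lambda>f. f) l)) \<and>
    linear_projection smul (perp X) \<pi> \<and>
    (\<forall>l\<in>Y_open emb (dual smul) A.
       pull_line (res_form X ` dual smul) (\<lambda>f. f \<circ> \<pi>) l
         \<in> Y_open emb (res_form X ` dual smul) (restr_quot A X) \<and>
       snd (dcp_inv emb (dual smul) A G X (r (Y_emb G l))) =
         Y_emb (restr_quot G X) (pull_line (res_form X ` dual smul) (\<lambda>f. f \<circ> \<pi>) l))"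
proof -
  let ?U = "dual smul"
  have W: "wonderful emb ?U A G"
    using assms by unfold_locales
  obtain N where "wonderful_complement emb ?U A G X N"
    using wonderful.ex_modular_complement[OF W assms(7,8,9)] ..
  then interpret wonderful_complement emb ?U A G X N .
  have D: "boundary_divisor emb ?U A G X = stratum X"
    using boundary_divisor_eq[OF assms(7,8,9)] .
  have "tau f \<in> ?U" if "f \<in> ?U" for f
    using tau_in_N[OF that] N_subset_U by blast
  \<comment> \<open>A projection of the dual with kernel \<open>X\<close> is the transpose of a
    projection of V onto X^perp.\<close>
  then obtain \<pi> where \<pi>: "linear_projection smul (perp X) \<pi>" "\<And>f. f \<in> ?U \<Longrightarrow> f \<circ> \<pi> = tau f"
    using linear_projection_of_dual[OF assms(2) subspace_U linear_tau _ X_subset_U tau_X diff_tau_in_X]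
    by blast
  have range: "range \<pi> \<subseteq> perp X"
    using \<pi>(1) by (simp add: linear_projection_def)
  show ?thesis
  proof (intro exI conjI ballI)
    show "regular_map emb G Ybar G (boundary_divisor emb ?U A G X) retr"
      unfolding D using Ybar_mproj retr_stratum stratumD(1) by (intro regular_retr) blast+
    show "retr p = p" if "p \<in> boundary_divisor emb ?U A G X" for p
      using that retr_id by (simp add: D)
    show "linear_projection smul (perp X) \<pi>"
      by (rule \<pi>(1))
  next
    fix l
    assume "l \<in> Y_open emb ?U A"
    then obtain \<phi> where \<phi>: "generic \<phi>" "l = line \<phi>"
      by (auto simp: Y_open_eq)
    note inv = dcp_inv_retr[OF range \<pi>(2) \<phi>(1)]
    show "pull_line X (\<lambda>f. f) l \<in> Y_open emb X (restr_sub A X)"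
      using sub_point(1)[OF \<phi>(1)] by (simp add: \<phi>(2) pull_line_line)
    show "fst (dcp_inv emb ?U A G X (retr (Y_emb G l))) = Y_emb (restr_sub G X) (pull_line X (\<lambda>f. f) l)"
      by (simp add: \<phi>(2) inv pull_line_line)
    show "pull_line (res_form X ` ?U) (\<lambda>f. f \<circ> \<pi>) l \<in> Y_open emb (res_form X ` ?U) (restr_quot A X)"
      using quot_point(1)[OF range \<pi>(2) \<phi>(1)] by (simp add: \<phi>(2) pull_line_line)
    show "snd (dcp_inv emb ?U A G X (retr (Y_emb G l))) =
      Y_emb (restr_quot G X) (pull_line (res_form X ` ?U) (\<lambda>f. f \<circ> \<pi>) l)"
      by (simp add: \<phi>(2) inv pull_line_line)
  qed
qed

end
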